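(* Let $n\ge2$ and $0\le\alpha<n$ be integers, let $\mathbf c_1,\dots,\mathbf c_{n-1},\mathbf b_1,\dots,\mathbf b_{n-1},\mathbf d\in\mathbb H$, and consider the equation $$\sum_{r=1}^{\alpha}\mathbf c_r\mathbf q\mathbf b_r-\sum_{r=\alpha+1}^{n-1}\mathbf c_r\overline{\mathbf q}\mathbf b_r=\mathbf d$$ in the unknown $\mathbf q\in\mathbb H$. Let $\mathbf M$ be the real $4\times4$ matrix of the linear map $\mathbf q\mapsto\sum_{r=1}^{\alpha}\mathbf c_r\mathbf q\mathbf b_r-\sum_{r=\alpha+1}^{n-1}\mathbf c_r\overline{\mathbf q}\mathbf b_r$, let $\mathbf A$ be the real $4\times 4$ matrix of the linear map $\mathbf q\mapsto\sum_{r=1}^{n-1}\mathbf c_r\mathbf q\mathbf b_r$ (both in the basis $1,\mathbf i,\mathbf j,\mathbf k$), and let $\mathbf h:=\sum_{r=1}^{\alpha}\mathbf c_r\mathbf b_r-\sum_{r=\alpha+1}^{n-1}\mathbf c_r\mathbf b_r$. With the real number $\Delta$ and the linear operator $\Phi$ on $\mathbb H$ defined from the $\mathbf c_r,\mathbf b_r$ as in the context: when $\det(\mathbf A)=-\Delta/3\neq0$ and $\det(\mathbf M)=-\mathrm{Re}(\Phi\mathbf h)/3\neq0$, the solution $\mathbf q$ of the equation is given by $$\Delta\,\mathrm{Re}(\Phi\mathbf h)\,\mathbf q=\Delta\,\mathrm{Re}(\Phi\mathbf d)-\mathrm{Re}(\Phi\mathbf d)\,\Phi\mathbf h+\mathrm{Re}(\Phi\mathbf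 h)\,\Phi\mathbf d.$$
   Context: $\mathbb H$ is the algebra of real quaternions with basis $1,\mathbf i,\mathbf j,\mathbf k$; the over-bar is quaternionic conjugation and $\mathrm{Re}$ the real part. For $\mathbf u,\mathbf v\in\mathbb H$, $(\mathbf u\,|\,\mathbf v)$ is the real-linear operator $\mathbf q\mapsto\mathbf u\mathbf q\mathbf v$ on $\mathbb H$. Let $\mathbf e_0,\mathbf e_1,\mathbf e_2,\mathbf e_3$ be an orthonormal basis of Euclidean $\mathbb R^4$ (inner product denoted by a dot), $\mathbf f:\mathbb H\to\mathbb R^4$ the linear isomorphism $1\mapsto\mathbf e_0$, $\mathbf i\mapsto\mathbf e_1$, $\mathbf j\mapsto\mathbf e_2$, $\mathbf k\mapsto\mathbf e_3$, and $\acute{\mathbf a}:=\mathbf f(\mathbf a)$. $CL(\mathbb R^4)$ is the Clifford algebra with $\mathbf x\mathbf x=\mathbf x\cdot\mathbf x$ for $\mathbf x\in\mathbb R^4$; $\wedge$ is the outer product; $\mathbf I_4:=\mathbf e_0\mathbf e_1\mathbf e_2\mathbf e_3$; $X^\sim:=X\mathbf I_4$. The bracket $[\mathbf x_1\mathbf x_2\mathbf x_3\mathbf x_4]:=(\mathbf x_1\wedge\mathbf x_2\wedge\mathbf x_3\wedge\mathbf x_4)^\sim$ is the determinant of the matrix with rows the coordinates of $\mathbf x_1,\dots,\mathbf x_4$. Put $\overline{\mathbf c}_{pqr}^{\sim}:=\mathbf f^{-1}\big((\mathbf f(\overline{\mathbf c_p})\wedge\mathbf f(\overline{\mathbf c_q})\wedge\mathbf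 f(\overline{\mathbf c_r}))^\sim\big)\in\mathbb H$, and similarly $\overline{\mathbf b}_{pqr}^{\sim}$. Define $$\Delta:=\sum_{p,q,r,s=1}^{n-1}\Big\{[\acute{\mathbf c}_p\acute{\mathbf c}_q\acute{\mathbf c}_r\acute{\mathbf c}_s][\acute{\mathbf b}_p\acute{\mathbf b}_q\acute{\mathbf b}_r\acute{\mathbf b}_s]+3(\acute{\mathbf c}_p\cdot\acute{\mathbf c}_q)(\acute{\mathbf c}_r\cdot\acute{\mathbf c}_s)(\acute{\mathbf b}_p\cdot\acute{\mathbf b}_q)(\acute{\mathbf b}_r\cdot\acute{\mathbf b}_s)-6(\acute{\mathbf c}_p\cdot\acute{\mathbf c}_q)(\acute{\mathbf c}_r\cdot\acute{\mathbf c}_s)(\acute{\mathbf b}_q\cdot\acute{\mathbf b}_s)(\acute{\mathbf b}_p\cdot\acute{\mathbf b}_r)\Big\},$$ $$\Phi:=\sum_{p,q,r=1}^{n-1}\Big\{(\overline{\mathbf c}_{pqr}^{\sim}\,|\,\overline{\mathbf b}_{pqr}^{\sim})+3(\acute{\mathbf c}_p\cdot\acute{\mathbf c}_r)(\acute{\mathbf b}_p\cdot\acute{\mathbf b}_r)(\overline{\mathbf c}_q\,|\,\overline{\mathbf b}_q)-6(\acute{\mathbf c}_p\cdot\acute{\mathbf c}_r)(\acute{\mathbf b}_q\cdot\acute{\mathbf b}_r)(\overline{\mathbf c}_q\,|\,\overline{\mathbf b}_p)\Big\}.$$ *)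

theory Defs
  imports "HOL-Analysis.Analysis"
begin

section \<open>Real quaternions\<close>

datatype quaternion =
  Quat (qRe: real) (qIm1: real) (qIm2: real) (qIm3: real)

instantiation quaternion :: real_algebra_1
begin

definition "0 = Quat 0 0 0 0"
definition "1 = Quat 1 0 0 0"
definition "p + q = Quat (qRe p + qRe q) (qIm1 p + qIm1 q) (qIm2 p + qIm2 q) (qIm3 p + qIm3 q)"
definition "- q = Quat (- qRe q) (- qIm1 q) (- qIm2 q) (- qIm3 q)"
definition "p - q = Quat (qRe p - qRe q) (qIm1 p - qIm1 q) (qIm2 p - qIm2 q) (qIm3 p - qIm3 q)"
definition "t *\<^sub>R q = Quat (t * qRe q) (t * qIm1 q) (t * qIm2 q) (t * qIm3 q)"
definition "p * q = Quat
  (qRe p * qRe q - qIm1 p * qIm1 q - qIm2 p * qIm2 q - qIm3 p * qIm3 q)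
  (qRe p * qIm1 q + qIm1 p * qRe q + qIm2 p * qIm3 q - qIm3 p * qIm2 q)
  (qRe p * qIm2 q - qIm1 p * qIm3 q + qIm2 p * qRe q + qIm3 p * qIm1 q)
  (qRe p * qIm3 q + qIm1 p * qIm2 q - qIm2 p * qIm1 q + qIm3 p * qRe q)"

lemmas quaternion_defs =
  zero_quaternion_def one_quaternion_def plus_quaternion_def uminus_quaternion_def
  minus_quaternion_def scaleR_quaternion_def times_quaternion_def

instance
  by standard (simp_all add: quaternion_defs algebra_simps)

end

definition qcnj :: "quaternion \<Rightarrow> quaternion" where
  "qcnj q = Quat (qRe q) (- qIm1 q) (- qIm2 q) (- qIm3 q)"

text \<open>
  Coordinates in $\mathbb{H}$ and in $\mathbb{R}^4$ are indexed by the elements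
  \<open>0, 1, 2, 3\<close> of the type \<open>4\<close>.
\<close>

definition quat_basis :: "4 \<Rightarrow> quaternion" where
  "quat_basis i = (if i = 0 then Quat 1 0 0 0 else if i = 1 then Quat 0 1 0 0
                   else if i = 2 then Quat 0 0 1 0 else Quat 0 0 0 1)"

definition quat_coord :: "quaternion \<Rightarrow> 4 \<Rightarrow> real" where
  "quat_coord q i = (if i = 0 then qRe q else if i = 1 then qIm1 q
                     else if i = 2 then qIm2 q else qIm3 q)"

lemma UNIV_4: "(UNIV :: 4 set) = {0, 1, 2, 3}"
proof -
  have "x \<in> {0, 1, 2, 3}" for x :: 4
  proof -
    have "(4 :: 4) = 0" by simp
    then show ?thesis using exhaust_4 [of x] by (metis insertCI)
  qed
  then show ?thesis by blast
qed

lemma distinct_4: "distinct [0, 1, 2, 3 :: 4]"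
  by simp

lemma sum_4: "(\<Sum>i\<in>UNIV. f i) = f (0::4) + f 1 + f 2 + f 3"
  unfolding UNIV_4 using distinct_4 by (simp add: add.assoc)

lemma quat_basis_coord: "(\<Sum>i\<in>UNIV. quat_coord q i *\<^sub>R quat_basis i) = q"
  unfolding sum_4 by (cases q) (simp add: quat_coord_def quat_basis_def quaternion_defs)

definition quat_matrix :: "(quaternion \<Rightarrow> quaternion) \<Rightarrow> real^4^4" where
  "quat_matrix L = (\<chi> i j. quat_coord (L (quat_basis j)) i)"

text \<open>The operator $(u \mid v)$.\<close>

definition two_sided :: "quaternion \<Rightarrow> quaternion \<Rightarrow> quaternion \<Rightarrow> quaternion" where
  "two_sided u v = (\<lambda>q. u * q * v)"


section \<open>The Clifford algebra of Euclidean space\<close>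

text \<open>
  A multivector over \<open>real^'n\<close> is given by its coefficients with respect to the
  basis blades $e_A = e_{i_1} \cdots e_{i_k}$, $A = \{i_1 < \dots < i_k\}$, where
  the $e_i$ are the standard unit vectors.
\<close>

datatype 'n clifford = Clifford (blade_coeff: "'n set \<Rightarrow> real")

lemma clifford_eqI: "(\<And>A. blade_coeff X A = blade_coeff Y A) \<Longrightarrow> X = Y"
  by (cases X; cases Y) auto

instantiation clifford :: (type) real_vector
begin

definition "0 = Clifford (\<lambda>A. 0)"
definition "X + Y = Clifford (\<lambda>A. blade_coeff X A + blade_coeff Y A)"
definition "- X = Clifford (\<lambda>A. - blade_coeff X A)"
definition "X - Y = Clifford (\<lambda>A. blade_coeff X A - blade_coeff Y A)"
definition "t *\<^sub>R X = Clifford (\<lambda>A. t * blade_coeff X A)"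

instance
  by standard (simp_all add: zero_clifford_def plus_clifford_def uminus_clifford_def
      minus_clifford_def scaleR_clifford_def algebra_simps)

end

lemma blade_coeff_linear [simp]:
  "blade_coeff 0 A = 0"
  "blade_coeff (X + Y) A = blade_coeff X A + blade_coeff Y A"
  "blade_coeff (- X) A = - blade_coeff X A"
  "blade_coeff (X - Y) A = blade_coeff X A - blade_coeff Y A"
  "blade_coeff (t *\<^sub>R X) A = t * blade_coeff X A"
  by (simp_all add: zero_clifford_def plus_clifford_def uminus_clifford_def
      minus_clifford_def scaleR_clifford_def)

lemma blade_coeff_sum [simp]:
  "blade_coeff (\<Sum>i\<in>I. f i) A = (\<Sum>i\<in>I. blade_coeff (f i) A)"
  by (induction I rule: infinite_finite_induct) auto

text \<open>
  Since $e_i e_i = 1$ and $e_i e_j = - e_j e_i$ for $i \neq j$, we have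
  $e_A e_B = \pm e_{A \mathbin{\triangle} B}$, the sign being the parity of the number of
  pairs $(i, j) \in A \times B$ with $j < i$.  The blade $e_C$ thus arises from the
  pairs $(A, A \mathbin{\triangle} C)$.
\<close>

definition blade_sign :: "'n::linorder set \<Rightarrow> 'n set \<Rightarrow> real" where
  "blade_sign A B = (\<Prod>i\<in>A. \<Prod>j\<in>B. if j < i then -1 else 1)"

lemma prod_pm_sym_diff:
  fixes f :: "'a \<Rightarrow> real"
  assumes "finite A" "finite B" and "\<And>i. f i * f i = 1"
  shows "prod f (sym_diff A B) = prod f A * prod f B"
proof -
  have sq: "prod f (A \<inter> B) * prod f (A \<inter> B) = 1"
    using assms(3) by (simp flip: prod.distrib)
  have A: "prod f A = prod f (A - B) * prod f (A \<inter> B)"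
    using assms(1) by (simp add: prod.Int_Diff [of A f B] mult.commute)
  have B: "prod f B = prod f (B - A) * prod f (A \<inter> B)"
    using assms(2) by (simp add: prod.Int_Diff [of B f A] mult.commute inf_commute)
  have "prod f (sym_diff A B) = prod f (A - B) * prod f (B - A)"
    using prod.union_disjoint [of "A - B" "B - A" f] assms(1,2) by auto
  also have "\<dots> = prod f (A - B) * prod f (B - A) * (prod f (A \<inter> B) * prod f (A \<inter> B))"
    using sq by simp
  finally show ?thesis by (simp add: A B)
qed

lemma blade_sign_square:
  fixes A B :: "'n::linorder set"
  shows "blade_sign A B * blade_sign A B = 1"
  by (auto simp: blade_sign_def simp flip: prod.distrib intro!: prod.neutral)

lemma blade_sign_sym_diff_left:
  fixes A B C :: "'n::{finite,linorder} set"
  shows "blade_sign (sym_diff A B) C = blade_sign A C * blade_sign B C"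
  unfolding blade_sign_def
  by (rule prod_pm_sym_diff) (auto simp flip: prod.distrib intro!: prod.neutral)

lemma blade_sign_sym_diff_right:
  fixes A B C :: "'n::{finite,linorder} set"
  shows "blade_sign A (sym_diff B C) = blade_sign A B * blade_sign A C"
proof -
  have "blade_sign A (sym_diff B C) =
      (\<Prod>i\<in>A. (\<Prod>j\<in>B. if j < i then -1 else 1) * (\<Prod>j\<in>C. if j < i then -1 else 1))"
    unfolding blade_sign_def
    by (intro prod.cong refl prod_pm_sym_diff) auto
  then show ?thesis
    by (simp add: blade_sign_def prod.distrib)
qed

instantiation clifford :: ("{finite,linorder}") real_algebra_1
begin

definition "1 = Clifford (\<lambda>A. if A = {} then 1 else 0)"
definition "X * Y = Clifford (\<lambda>C. \<Sum>A\<in>UNIV.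
  blade_sign A (sym_diff A C) * blade_coeff X A * blade_coeff Y (sym_diff A C))"

instance
proof
  fix X Y Z :: "'a clifford" and t :: real
  show "X * Y * Z = X * (Y * Z)"
  proof (rule clifford_eqI)
    fix D :: "'a set"
    let ?x = "blade_coeff X" and ?y = "blade_coeff Y" and ?z = "blade_coeff Z"
    have canc: "sym_diff A (sym_diff A C) = C" for A C :: "'a set"
      by auto
    have "blade_coeff (X * Y * Z) D = (\<Sum>C\<in>UNIV. \<Sum>A\<in>UNIV.
        blade_sign C (sym_diff C D) * (blade_sign A (sym_diff A C) * ?x A * ?y (sym_diff A C))
          * ?z (sym_diff C D))"
      by (simp add: times_clifford_def sum_distrib_left sum_distrib_right)
    also have "\<dots> = (\<Sum>A\<in>UNIV. \<Sum>C\<in>UNIV.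
        blade_sign C (sym_diff C D) * (blade_sign A (sym_diff A C) * ?x A * ?y (sym_diff A C))
          * ?z (sym_diff C D))"
      by (rule sum.swap)
    also have "\<dots> = (\<Sum>A\<in>UNIV. \<Sum>B\<in>UNIV.
        blade_sign A (sym_diff A D) * ?x A *
          (blade_sign B (sym_diff B (sym_diff A D)) * ?y B * ?z (sym_diff B (sym_diff A D))))"
    proof (rule sum.cong [OF refl])
      fix A :: "'a set"
      have "bij (\<lambda>B. sym_diff A B)"
        by (rule bij_betw_byWitness [where f' = "\<lambda>B. sym_diff A B"]) auto
      then have "(\<Sum>C\<in>UNIV. blade_sign C (sym_diff C D) *
            (blade_sign A (sym_diff A C) * ?x A * ?y (sym_diff A C)) * ?z (sym_diff C D)) =
          (\<Sum>B\<in>UNIV. blade_sign (sym_diff A B) (sym_diff (sym_diff A B) D) *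
            (blade_sign A (sym_diff A (sym_diff A B)) * ?x A * ?y (sym_diff A (sym_diff A B))) *
            ?z (sym_diff (sym_diff A B) D))"
        by (rule sum.reindex_bij_betw [symmetric])
      also have "\<dots> = (\<Sum>B\<in>UNIV. blade_sign A (sym_diff A D) * ?x A *
          (blade_sign B (sym_diff B (sym_diff A D)) * ?y B * ?z (sym_diff B (sym_diff A D))))"
      proof (rule sum.cong [OF refl])
        fix B :: "'a set"
        have 1: "sym_diff (sym_diff A B) D = sym_diff B (sym_diff A D)" by auto
        have sq: "blade_sign A B * (blade_sign A B * t) = t" for t
          using blade_sign_square [of A B] by (simp flip: mult.assoc)
        have 2: "blade_sign (sym_diff A B) (sym_diff B (sym_diff A D)) * blade_sign A B =
            blade_sign A (sym_diff A D) * blade_sign B (sym_diff B (sym_diff A D))"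
          by (simp only: blade_sign_sym_diff_left blade_sign_sym_diff_right mult_ac sq)
        show "blade_sign (sym_diff A B) (sym_diff (sym_diff A B) D) *
            (blade_sign A (sym_diff A (sym_diff A B)) * ?x A * ?y (sym_diff A (sym_diff A B))) *
            ?z (sym_diff (sym_diff A B) D) =
          blade_sign A (sym_diff A D) * ?x A *
          (blade_sign B (sym_diff B (sym_diff A D)) * ?y B * ?z (sym_diff B (sym_diff A D)))"
          unfolding 1 canc using arg_cong [OF 2, of "\<lambda>s. s * (?x A * ?y B * ?z (sym_diff B (sym_diff A D)))"]
          by (simp only: mult_ac)
      qed
      finally show "(\<Sum>C\<in>UNIV. blade_sign C (sym_diff C D) *
            (blade_sign A (sym_diff A C) * ?x A * ?y (sym_diff A C)) * ?z (sym_diff C D)) =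
          (\<Sum>B\<in>UNIV. blade_sign A (sym_diff A D) * ?x A *
          (blade_sign B (sym_diff B (sym_diff A D)) * ?y B * ?z (sym_diff B (sym_diff A D))))" .
    qed
    also have "\<dots> = blade_coeff (X * (Y * Z)) D"
      by (simp add: times_clifford_def sum_distrib_left)
    finally show "blade_coeff (X * Y * Z) D = blade_coeff (X * (Y * Z)) D" .
  qed
  show "1 * X = X"
  proof (rule clifford_eqI)
    fix C :: "'a set"
    have "blade_coeff (1 * X) C = (\<Sum>A\<in>(UNIV :: 'a set set). if A = {} then blade_coeff X C else 0)"
      unfolding times_clifford_def one_clifford_def clifford.sel
      by (intro sum.cong refl) (simp add: blade_sign_def)
    then show "blade_coeff (1 * X) C = blade_coeff X C" by simp
  qed
  show "X * 1 = X"
  proof (rule clifford_eqI)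
    fix C :: "'a set"
    have eq: "sym_diff A C = {} \<longleftrightarrow> A = C" for A by auto
    have "blade_coeff (X * 1) C = (\<Sum>A\<in>UNIV. if A = C then blade_coeff X C else 0)"
      unfolding times_clifford_def one_clifford_def clifford.sel eq
      by (intro sum.cong refl) (simp add: blade_sign_def)
    then show "blade_coeff (X * 1) C = blade_coeff X C" by simp
  qed
  show "(X + Y) * Z = X * Z + Y * Z" "X * (Y + Z) = X * Y + X * Z"
    by (rule clifford_eqI; simp add: times_clifford_def algebra_simps sum.distrib)+
  show "t *\<^sub>R X * Y = t *\<^sub>R (X * Y)" "X * t *\<^sub>R Y = t *\<^sub>R (X * Y)"
    by (rule clifford_eqI; simp add: times_clifford_def algebra_simps sum_distrib_left)+
  show "(0 :: 'a clifford) \<noteq> 1"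
    by (auto simp: zero_clifford_def one_clifford_def fun_eq_iff)
qed

end

definition blade :: "'n set \<Rightarrow> 'n clifford" where
  "blade A = Clifford (\<lambda>B. if B = A then 1 else 0)"

lemma blade_coeff_blade [simp]: "blade_coeff (blade A) B = (if B = A then 1 else 0)"
  by (simp add: blade_def)

lemma blade_mult:
  fixes A B :: "'n::{finite,linorder} set"
  shows "blade A * blade B = blade_sign A B *\<^sub>R blade (sym_diff A B)"
proof (rule clifford_eqI)
  fix C :: "'n set"
  have eq: "sym_diff A C = B \<longleftrightarrow> C = sym_diff A B" by auto
  have "blade_coeff (blade A * blade B) C =
      (\<Sum>A'\<in>UNIV. if A' = A then (if sym_diff A C = B then blade_sign A B else 0) else 0)"
    unfolding times_clifford_def clifford.sel by (intro sum.cong refl) simp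
  also have "\<dots> = (if C = sym_diff A B then blade_sign A B else 0)"
    by (simp add: eq)
  finally show "blade_coeff (blade A * blade B) C =
      blade_coeff (blade_sign A B *\<^sub>R blade (sym_diff A B)) C" by simp
qed

definition cl_vec :: "real^'n::{finite,linorder} \<Rightarrow> 'n clifford" where
  "cl_vec x = (\<Sum>i\<in>UNIV. x $ i *\<^sub>R blade {i})"

lemma blade_singleton_square:
  fixes i :: "'n::{finite,linorder}"
  shows "blade {i} * blade {i} = 1"
proof -
  have "blade {} = (1 :: 'n clifford)"
    by (rule clifford_eqI) (simp add: one_clifford_def)
  then show ?thesis by (simp add: blade_mult blade_sign_def)
qed

lemma blade_singleton_anticommute:
  fixes i j :: "'n::{finite,linorder}"
  assumes "i \<noteq> j"
  shows "blade {i} * blade {j} = - (blade {j} * blade {i})"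
proof -
  have "sym_diff {i} {j} = sym_diff {j} {i}" by auto
  then show ?thesis using assms
    by (cases i j rule: linorder_cases) (auto simp: blade_mult blade_sign_def)
qed

lemma cl_vec_square:
  fixes x :: "real^'n::{finite,linorder}"
  shows "cl_vec x * cl_vec x = of_real (x \<bullet> x)"
proof -
  let ?p = "\<lambda>i j. blade {i} * blade {j} + blade {j} * blade {i} :: 'n clifford"
  have p: "?p i j = (if i = j then 2 *\<^sub>R 1 else 0)" for i j
    using blade_singleton_anticommute [of i j]
    by (simp add: blade_singleton_square scaleR_2)
  have e: "cl_vec x * cl_vec x =
      (\<Sum>i\<in>UNIV. \<Sum>j\<in>UNIV. (x $ i * x $ j) *\<^sub>R (blade {i} * blade {j}))"
    unfolding cl_vec_def sum_product
    by (intro sum.cong refl) (simp add: mult.commute)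
  have e': "cl_vec x * cl_vec x =
      (\<Sum>i\<in>UNIV. \<Sum>j\<in>UNIV. (x $ i * x $ j) *\<^sub>R (blade {j} * blade {i}))"
    unfolding e by (subst sum.swap) (simp only: mult.commute)
  have "2 *\<^sub>R (cl_vec x * cl_vec x) = cl_vec x * cl_vec x + cl_vec x * cl_vec x"
    by (rule scaleR_2)
  also have "\<dots> = (\<Sum>i\<in>UNIV. \<Sum>j\<in>UNIV. (x $ i * x $ j) *\<^sub>R ?p i j)"
    by (subst (1) e, subst (1) e') (simp only: scaleR_add_right sum.distrib)
  also have "\<dots> = (\<Sum>i\<in>UNIV. (x $ i * x $ i) *\<^sub>R 2 *\<^sub>R (1 :: 'n clifford))"
  proof (rule sum.cong [OF refl])
    fix i
    have "(\<Sum>j\<in>UNIV. (x $ i * x $ j) *\<^sub>R ?p i j) =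
        (\<Sum>j\<in>UNIV. if i = j then (x $ i * x $ i) *\<^sub>R 2 *\<^sub>R (1 :: 'n clifford) else 0)"
      by (rule sum.cong [OF refl]) (simp add: p)
    then show "(\<Sum>j\<in>UNIV. (x $ i * x $ j) *\<^sub>R ?p i j) =
        (x $ i * x $ i) *\<^sub>R 2 *\<^sub>R (1 :: 'n clifford)" by simp
  qed
  also have "\<dots> = 2 *\<^sub>R of_real (x \<bullet> x)"
    unfolding inner_vec_def of_real_def
    by (simp only: scaleR_sum_left scaleR_sum_right scaleR_scaleR inner_real_def mult.commute)
  finally show ?thesis by simp
qed

text \<open>The outer product keeps exactly the part of $e_A e_B$ with $A \cap B = \emptyset$.\<close>

definition outer :: "'n::{finite,linorder} clifford \<Rightarrow> 'n clifford \<Rightarrow> 'n clifford"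
    (infixl "\<and>\<^sub>c" 70) where
  "X \<and>\<^sub>c Y = Clifford (\<lambda>C. \<Sum>A\<in>Pow C.
     blade_sign A (C - A) * blade_coeff X A * blade_coeff Y (C - A))"

lemma blade_outer:
  fixes A B :: "'n::{finite,linorder} set"
  shows "blade A \<and>\<^sub>c blade B = (if A \<inter> B = {} then blade A * blade B else 0)"
proof (rule clifford_eqI)
  fix C :: "'n set"
  have "blade_coeff (blade A \<and>\<^sub>c blade B) C =
      (\<Sum>A'\<in>Pow C. if A' = A then (if C - A = B then blade_sign A B else 0) else 0)"
    unfolding outer_def clifford.sel by (intro sum.cong refl) simp
  also have "\<dots> = (if A \<subseteq> C \<and> C - A = B then blade_sign A B else 0)"
    by simp
  also have "\<dots> = blade_coeff (if A \<inter> B = {} then blade A * blade B else 0) C"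
  proof -
    have eq: "A \<subseteq> C \<and> C - A = B \<longleftrightarrow> A \<inter> B = {} \<and> C = sym_diff A B" by blast
    show ?thesis unfolding eq blade_mult by (cases "A \<inter> B = {}") simp_all
  qed
  finally show "blade_coeff (blade A \<and>\<^sub>c blade B) C =
      blade_coeff (if A \<inter> B = {} then blade A * blade B else 0) C" .
qed

definition scalar_part :: "'n clifford \<Rightarrow> real" where
  "scalar_part X = blade_coeff X {}"


section \<open>The data attached to an orthonormal basis of \<open>real^4\<close>\<close>

definition orthonormal_basis4 :: "(4 \<Rightarrow> real^4) \<Rightarrow> bool" where
  "orthonormal_basis4 e \<longleftrightarrow> (\<forall>i j. e i \<bullet> e j = (if i = j then 1 else 0))"

text \<open>
  The isomorphism $f : \mathbb{H} \to \mathbb{R}^4$ determined by the basis \<open>e\<close>, written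
  \<open>qvec e\<close> here.
\<close>

definition qvec :: "(4 \<Rightarrow> real^4) \<Rightarrow> quaternion \<Rightarrow> real^4" where
  "qvec e q = (\<Sum>i\<in>UNIV. quat_coord q i *\<^sub>R e i)"

definition pseudoscalar :: "(4 \<Rightarrow> real^4) \<Rightarrow> 4 clifford" where
  "pseudoscalar e = cl_vec (e 0) * cl_vec (e 1) * cl_vec (e 2) * cl_vec (e 3)"

definition dual :: "(4 \<Rightarrow> real^4) \<Rightarrow> 4 clifford \<Rightarrow> 4 clifford" where
  "dual e X = X * pseudoscalar e"

text \<open>The argument of \<open>scalar_part\<close> is a real multiple of \<open>1\<close>.\<close>

definition bracket ::
    "(4 \<Rightarrow> real^4) \<Rightarrow> real^4 \<Rightarrow> real^4 \<Rightarrow> real^4 \<Rightarrow> real^4 \<Rightarrow> real" where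
  "bracket e x1 x2 x3 x4 =
     scalar_part (dual e (cl_vec x1 \<and>\<^sub>c cl_vec x2 \<and>\<^sub>c cl_vec x3 \<and>\<^sub>c cl_vec x4))"

text \<open>
  \<open>tri_dual e\<close> applied to $c_p, c_q, c_r$ is $\overline{c}_{pqr}^{\sim}$.  The dual of a
  trivector is a vector, hence in the range of \<open>\<lambda>u. cl_vec (qvec e u)\<close>, which is
  injective if \<open>e\<close> is a basis.
\<close>

definition tri_dual ::
    "(4 \<Rightarrow> real^4) \<Rightarrow> quaternion \<Rightarrow> quaternion \<Rightarrow> quaternion \<Rightarrow> quaternion" where
  "tri_dual e u v w = inv (\<lambda>q. cl_vec (qvec e q))
     (dual e (cl_vec (qvec e (qcnj u)) \<and>\<^sub>c cl_vec (qvec e (qcnj v)) \<and>\<^sub>c cl_vec (qvec e (qcnj w))))"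

definition Delta ::
    "(4 \<Rightarrow> real^4) \<Rightarrow> nat \<Rightarrow> (nat \<Rightarrow> quaternion) \<Rightarrow> (nat \<Rightarrow> quaternion) \<Rightarrow> real" where
  "Delta e n c b = (let f = qvec e; I = {1..n-1} in
     \<Sum>p\<in>I. \<Sum>q\<in>I. \<Sum>r\<in>I. \<Sum>s\<in>I.
        bracket e (f (c p)) (f (c q)) (f (c r)) (f (c s)) *
        bracket e (f (b p)) (f (b q)) (f (b r)) (f (b s))
      + 3 * (f (c p) \<bullet> f (c q)) * (f (c r) \<bullet> f (c s)) * (f (b p) \<bullet> f (b q)) * (f (b r) \<bullet> f (b s))
      - 6 * (f (c p) \<bullet> f (c q)) * (f (c r) \<bullet> f (c s)) * (f (b q) \<bullet> f (b s)) * (f (b p) \<bullet> f (b r)))"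

definition Phi ::
    "(4 \<Rightarrow> real^4) \<Rightarrow> nat \<Rightarrow> (nat \<Rightarrow> quaternion) \<Rightarrow> (nat \<Rightarrow> quaternion) \<Rightarrow> quaternion \<Rightarrow> quaternion"
  where
  "Phi e n c b x = (let f = qvec e; I = {1..n-1} in
     \<Sum>p\<in>I. \<Sum>q\<in>I. \<Sum>r\<in>I.
        two_sided (tri_dual e (c p) (c q) (c r)) (tri_dual e (b p) (b q) (b r)) x
      + (3 * (f (c p) \<bullet> f (c r)) * (f (b p) \<bullet> f (b r))) *\<^sub>R two_sided (qcnj (c q)) (qcnj (b q)) x
      - (6 * (f (c p) \<bullet> f (c r)) * (f (b q) \<bullet> f (b r))) *\<^sub>R two_sided (qcnj (c q)) (qcnj (b p)) x)"

end

(* Everything is expressed through the 4x4 matrix T_ij = sum_r (c_r)_i (b_r)_j.  In coordinates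
   Phi = sum_jk G_jk (conj e_j | conj e_k) with G = 6 cof(T) + 3 |T|^2 T - 6 T T^t T, where the
   cofactors come from the Cauchy-Binet formula, and Delta = <G, T>.  The entries of A are linear
   in T, and Phi = -3 adj(A) is an identity between cubic polynomials in the T_ij; taking the
   trace of Phi A = -3 det(A) gives det(A) = -Delta/3.  Since conj q = 2 Re q - q, the map of the
   equation is F q = A (q - Re q) + (Re q) h, so M is A with its first column replaced by h and
   det(M) is given by Cramer's rule.  Applying Phi to F q = d yields
   Phi d = Delta (q - Re q) + (Re q) Phi h, and its real part determines Re q. *)

theory Submission
  imports Defs
begin

section \<open>Determinants of order three and four\<close>

text \<open>The 3x3 minor with rows \<open>i\<close>, \<open>j\<close>, \<open>k\<close> and columns
  \<open>l\<close>, \<open>m\<close>, \<open>n\<close>. Row labels have an arbitrary type, so that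
  rows can be vectors, quaternions or summation indices.\<close>

definition minor3 :: "('a \<Rightarrow> 'b \<Rightarrow> real) \<Rightarrow> 'a \<Rightarrow> 'a \<Rightarrow> 'a \<Rightarrow> 'b \<Rightarrow> 'b \<Rightarrow> 'b \<Rightarrow> real" where
  "minor3 M i j k l m n = M i l * (M j m * M k n - M j n * M k m)
    - M i m * (M j l * M k n - M j n * M k l) + M i n * (M j l * M k m - M j m * M k l)"

text \<open>One round of summation for \<open>cauchy_binet3\<close>: it evaluates the sum over one
  index of a product of two linear forms.\<close>

lemma bilinear_sum3:
  fixes x0 x1 x2 y0 y1 y2 :: "'a \<Rightarrow> real"
  shows "(\<Sum>p\<in>I. (a0 * x0 p + a1 * x1 p + a2 * x2 p) * (b0 * y0 p + b1 * y1 p + b2 * y2 p)) =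
    a0 * b0 * (\<Sum>p\<in>I. x0 p * y0 p) + a0 * b1 * (\<Sum>p\<in>I. x0 p * y1 p) + a0 * b2 * (\<Sum>p\<in>I. x0 p * y2 p) +
    a1 * b0 * (\<Sum>p\<in>I. x1 p * y0 p) + a1 * b1 * (\<Sum>p\<in>I. x1 p * y1 p) + a1 * b2 * (\<Sum>p\<in>I. x1 p * y2 p) +
    a2 * b0 * (\<Sum>p\<in>I. x2 p * y0 p) + a2 * b1 * (\<Sum>p\<in>I. x2 p * y1 p) + a2 * b2 * (\<Sum>p\<in>I. x2 p * y2 p)"
  by (simp add: sum_distrib_left sum.distrib algebra_simps)

text \<open>Each set of three indices occurs in 3! = 6 orders, and a product of two minors is the
  same in all of them. The proof sums over \<open>r\<close>, then \<open>q\<close>, then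
  \<open>p\<close>, and compares polynomials in the nine remaining sums.\<close>

lemma cauchy_binet3:
  fixes X :: "'i \<Rightarrow> 'a \<Rightarrow> real" and Y :: "'i \<Rightarrow> 'b \<Rightarrow> real"
  shows "(\<Sum>p\<in>I. \<Sum>q\<in>I. \<Sum>r\<in>I. minor3 X p q r i j k * minor3 Y p q r l m n) =
    6 * minor3 (\<lambda>a b. \<Sum>p\<in>I. X p a * Y p b) i j k l m n"
proof -
  have r: "minor3 X p q r i j k * minor3 Y p q r l m n =
    ((X p j * X q k - X p k * X q j) * X r i + (X p k * X q i - X p i * X q k) * X r j + (X p i * X q j - X p j * X q i) * X r k) *
    ((Y p m * Y q n - Y p n * Y q m) * Y r l + (Y p n * Y q l - Y p l * Y q n) * Y r m + (Y p l * Y q m - Y p m * Y q l) * Y r n)" for p q r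
    unfolding minor3_def by algebra
  \<comment> \<open>Zero coefficients are written out so that these linear forms in row
    \<open>q\<close> match \<open>bilinear_sum3\<close>.\<close>
  have q: "(X p j * X q k - X p k * X q j) = (0 * X q i + (- X p k) * X q j + X p j * X q k)"
     "(X p k * X q i - X p i * X q k) = (X p k * X q i + 0 * X q j + (- X p i) * X q k)"
     "(X p i * X q j - X p j * X q i) = ((- X p j) * X q i + X p i * X q j + 0 * X q k)" for p q
    by algebra+
  have q': "(Y p m * Y q n - Y p n * Y q m) = (0 * Y q l + (- Y p n) * Y q m + Y p m * Y q n)"
     "(Y p n * Y q l - Y p l * Y q n) = (Y p n * Y q l + 0 * Y q m + (- Y p l) * Y q n)"
     "(Y p l * Y q m - Y p m * Y q l) = ((- Y p m) * Y q l + Y p l * Y q m + 0 * Y q n)" for p q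
    by algebra+
  show ?thesis
    unfolding r bilinear_sum3 unfolding q q'
    unfolding sum.distrib sum_distrib_right[symmetric] bilinear_sum3
    by (simp add: sum_distrib_right[symmetric] sum_distrib_left[symmetric] sum.distrib sum_subtractf
        sum_negf algebra_simps) (unfold minor3_def, algebra)
qed

lemma det_4:
  fixes A :: "real^4^4"
  shows "det A = A$0$0 * minor3 (\<lambda>i j. A$i$j) 1 2 3 1 2 3 - A$0$1 * minor3 (\<lambda>i j. A$i$j) 1 2 3 0 2 3
     + A$0$2 * minor3 (\<lambda>i j. A$i$j) 1 2 3 0 1 3 - A$0$3 * minor3 (\<lambda>i j. A$i$j) 1 2 3 0 1 2"
proof -
  have f: "finite {1, 2, 3::4}" "0 \<notin> {1, 2, 3::4}"
          "finite {2, 3::4}" "1 \<notin> {2, 3::4}" "finite {3::4}" "2 \<notin> {3::4}" by auto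
  show ?thesis
    unfolding det_def UNIV_4
    unfolding sum_over_permutations_insert[OF f(1,2)]
    unfolding sum_over_permutations_insert[OF f(3,4)]
    unfolding sum_over_permutations_insert[OF f(5,6)]
    unfolding permutes_sing
    by (simp add: minor3_def algebra_simps sign_swap_id permutation_swap_id sign_compose sign_id permutation_compose)
qed


section \<open>Operators on the quaternions\<close>

text \<open>
  The indices other than \<open>i\<close>, ordered so that \<open>(idx1 i, idx2 i, idx3 i, i)\<close> is an even
  permutation of \<open>(0, 1, 2, 3)\<close>: this absorbs all signs of the cofactor expansion.
\<close>

definition idx1 :: "4 \<Rightarrow> 4" where "idx1 i = (if i = 0 then 1 else 0)"
definition idx2 :: "4 \<Rightarrow> 4" where "idx2 i = (if i = 0 \<or> i = 2 then 3 else if i = 1 then 2 else 1)"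
definition idx3 :: "4 \<Rightarrow> 4" where "idx3 i = (if i = 0 \<or> i = 3 then 2 else if i = 1 then 3 else 1)"

lemmas idx_defs = idx1_def idx2_def idx3_def

text \<open>
  For $T_{ij} = \sum_r (c_r)_i (b_r)_j$ these are the coefficients of $\Phi$ with respect to the
  operators $(\overline{e_j} \mid \overline{e_k})$, namely
  $6\,\mathrm{cof}(T) + 3 \|T\|^2 T - 6\, T T^t T$.
\<close>

definition phi_coeff :: "(4 \<Rightarrow> 4 \<Rightarrow> real) \<Rightarrow> 4 \<Rightarrow> 4 \<Rightarrow> real" where
  "phi_coeff T j k = 6 * minor3 T (idx1 j) (idx2 j) (idx3 j) (idx1 k) (idx2 k) (idx3 k)
    + 3 * (\<Sum>i\<in>UNIV. \<Sum>l\<in>UNIV. T i l * T i l) * T j k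
    - 6 * (\<Sum>i\<in>UNIV. \<Sum>l\<in>UNIV. T j l * T i l * T i k)"

text \<open>By bilinearity a sum of operators (c_r | b_r) depends only on the sums T_ij of products
  of coordinates; these are its coefficients here.\<close>

definition quat_op :: "(4 \<Rightarrow> 4 \<Rightarrow> real) \<Rightarrow> quaternion \<Rightarrow> quaternion" where
  "quat_op T x = (\<Sum>i\<in>UNIV. \<Sum>j\<in>UNIV. T i j *\<^sub>R (quat_basis i * x * quat_basis j))"

definition quat_op_cnj :: "(4 \<Rightarrow> 4 \<Rightarrow> real) \<Rightarrow> quaternion \<Rightarrow> quaternion" where
  "quat_op_cnj T x = (\<Sum>i\<in>UNIV. \<Sum>j\<in>UNIV. T i j *\<^sub>R (qcnj (quat_basis i) * x * qcnj (quat_basis j)))"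

section \<open>Coordinates of quaternions and of two-sided operators\<close>

lemma forall_4: "(\<forall>i::4. P i) \<longleftrightarrow> P 0 \<and> P 1 \<and> P 2 \<and> P 3"
proof -
  have "(\<forall>i::4. P i) \<longleftrightarrow> (\<forall>i\<in>UNIV. P i)" by simp
  then show ?thesis unfolding UNIV_4 by simp
qed

lemma quat_coord_eqI: "p = q" if "\<And>i. quat_coord p i = quat_coord q i"
  using that [of 0] that [of 1] that [of 2] that [of 3]
  by (simp add: quat_coord_def quaternion.expand)

lemma quat_coord_linear [simp]:
  "quat_coord (p + q) i = quat_coord p i + quat_coord q i"
  "quat_coord (p - q) i = quat_coord p i - quat_coord q i"
  "quat_coord (- q) i = - quat_coord q i"
  "quat_coord (t *\<^sub>R q) i = t * quat_coord q i"
  "quat_coord 0 i = 0"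
  by (simp_all add: quat_coord_def quaternion_defs)

lemma quat_coord_sum [simp]: "quat_coord (\<Sum>r\<in>I. g r) i = (\<Sum>r\<in>I. quat_coord (g r) i)"
  by (induction I rule: infinite_finite_induct) auto

lemma quat_coord_basis [simp]: "quat_coord (quat_basis j) i = (if i = j then 1 else 0)"
proof -
  have "\<forall>i j. quat_coord (quat_basis j) i = (if i = j then 1 else 0)"
    unfolding forall_4 by (simp add: quat_coord_def quat_basis_def)
  then show ?thesis by simp
qed

lemma quat_coord_0: "quat_coord q 0 = qRe q"
  by (simp add: quat_coord_def)

lemma quat_coord_qcnj: "quat_coord (qcnj q) i =
  (if i = 0 then quat_coord q i else - quat_coord q i)"
  by (simp add: quat_coord_def qcnj_def)

lemma quat_basis_0: "quat_basis 0 = 1"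
  by (simp add: quat_basis_def one_quaternion_def)

text \<open>With this explicit matrix, linear in \<open>T\<close>, statements about
  \<open>quat_op\<close> become polynomial identities in the entries of \<open>T\<close>.\<close>

lemma quat_op_eq: "quat_op T (Quat x0 x1 x2 x3) = Quat
   ((T 0 0 - T 1 1 - T 2 2 - T 3 3) * x0 + (- T 0 1 - T 1 0 + T 2 3 - T 3 2) * x1
    + (- T 0 2 - T 2 0 + T 3 1 - T 1 3) * x2 + (- T 0 3 - T 3 0 + T 1 2 - T 2 1) * x3)
   ((T 0 1 + T 1 0 + T 2 3 - T 3 2) * x0 + (T 0 0 - T 1 1 + T 2 2 + T 3 3) * x1
    + (T 0 3 - T 3 0 - T 1 2 - T 2 1) * x2 + (- T 0 2 + T 2 0 - T 1 3 - T 3 1) * x3)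
   ((T 0 2 + T 2 0 + T 3 1 - T 1 3) * x0 + (- T 0 3 + T 3 0 - T 1 2 - T 2 1) * x1
    + (T 0 0 + T 1 1 - T 2 2 + T 3 3) * x2 + (T 0 1 - T 1 0 - T 2 3 - T 3 2) * x3)
   ((T 0 3 + T 3 0 + T 1 2 - T 2 1) * x0 + (T 0 2 - T 2 0 - T 1 3 - T 3 1) * x1
    + (- T 0 1 + T 1 0 - T 2 3 - T 3 2) * x2 + (T 0 0 + T 1 1 + T 2 2 - T 3 3) * x3)"
  by (simp add: quat_op_def sum_4 quat_basis_def quaternion_defs algebra_simps)

text \<open>Conjugation fixes 1 and negates the other three units, so only signs of coefficients
  change.\<close>

lemma quat_op_cnj_eq:
  "quat_op_cnj T x =
    quat_op (\<lambda>i j. (if i = 0 then 1 else -1) * (if j = 0 then 1 else -1) * T i j) x"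
  by (cases x)
    (simp add: quat_op_cnj_def quat_op_eq sum_4 quat_basis_def qcnj_def quaternion_defs algebra_simps)

lemma quat_op_sum: "(\<Sum>r\<in>I. quat_op (T r) x) = quat_op (\<lambda>i j. \<Sum>r\<in>I. T r i j) x"
  by (simp add: quat_op_def sum_4 sum.distrib scaleR_sum_left)

lemma quat_op_cnj_sum:
  "(\<Sum>r\<in>I. quat_op_cnj (T r) x) = quat_op_cnj (\<lambda>i j. \<Sum>r\<in>I. T r i j) x"
  by (simp add: quat_op_cnj_def sum_4 sum.distrib scaleR_sum_left)

lemma quat_op_cnj_add:
  "quat_op_cnj T x + quat_op_cnj U x = quat_op_cnj (\<lambda>i j. T i j + U i j) x"
  by (simp add: quat_op_cnj_def sum.distrib scaleR_add_left)

lemma quat_op_cnj_diff: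
  "quat_op_cnj T x - quat_op_cnj U x = quat_op_cnj (\<lambda>i j. T i j - U i j) x"
  by (simp add: quat_op_cnj_def sum_subtractf scaleR_diff_left)

lemma quat_op_cnj_scaleR: "t *\<^sub>R quat_op_cnj T x = quat_op_cnj (\<lambda>i j. t * T i j) x"
  by (simp add: quat_op_cnj_def scaleR_sum_right)

text \<open>Coefficients of rank one give a single operator (u | v); together with
  \<open>quat_op_sum\<close> this covers all sums of such operators.\<close>

lemma quat_op_rank1: "quat_op (\<lambda>i j. quat_coord u i * quat_coord v j) x = u * x * v"
  by (cases u; cases v; cases x) (simp add: quat_op_eq quat_coord_def quaternion_defs algebra_simps)

lemma quat_op_cnj_rank1:
  "quat_op_cnj (\<lambda>i j. quat_coord u i * quat_coord v j) x = qcnj u * x * qcnj v"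
  by (cases u; cases v; cases x)
    (simp add: quat_op_cnj_eq quat_op_eq quat_coord_def qcnj_def quaternion_defs algebra_simps)

lemma linear_quat_op_cnj: "linear (quat_op_cnj T)"
  by (rule linearI)
    (simp_all add: quat_op_cnj_def algebra_simps sum.distrib scaleR_sum_right)

lemma quat_coord_matrix:
  assumes "linear L"
  shows "quat_coord (L x) i = (quat_matrix L *v (\<chi> j. quat_coord x j)) $ i"
proof -
  have "L x = (\<Sum>j\<in>UNIV. quat_coord x j *\<^sub>R L (quat_basis j))"
    by (subst quat_basis_coord [of x, symmetric])
      (simp only: linear_sum [OF assms] linear_cmul [OF assms])
  then show ?thesis
    by (simp add: matrix_vector_mult_def quat_matrix_def mult.commute)
qed

text \<open>The polynomial identity $\Phi = -3\, \mathrm{adj}(A)$, in the form of Cramer's rule.\<close>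

lemma quat_coord_phi_0:
  "quat_coord (quat_op_cnj (phi_coeff T) (Quat x0 x1 x2 x3)) 0 =
    - 3 * det (\<chi> i j. if j = 0 then quat_coord (Quat x0 x1 x2 x3) i else quat_matrix (quat_op T) $ i $ j)"
  by (simp add: det_4 quat_op_cnj_eq quat_op_eq quat_coord_def quat_matrix_def quat_basis_def
     minor3_def phi_coeff_def idx_defs sum_4 del: minus_diff_eq) algebra

lemma quat_coord_phi_1:
  "quat_coord (quat_op_cnj (phi_coeff T) (Quat x0 x1 x2 x3)) 1 =
    - 3 * det (\<chi> i j. if j = 1 then quat_coord (Quat x0 x1 x2 x3) i else quat_matrix (quat_op T) $ i $ j)"
  by (simp add: det_4 quat_op_cnj_eq quat_op_eq quat_coord_def quat_matrix_def quat_basis_def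
     minor3_def phi_coeff_def idx_defs sum_4 del: minus_diff_eq) algebra

lemma quat_coord_phi_2:
  "quat_coord (quat_op_cnj (phi_coeff T) (Quat x0 x1 x2 x3)) 2 =
    - 3 * det (\<chi> i j. if j = 2 then quat_coord (Quat x0 x1 x2 x3) i else quat_matrix (quat_op T) $ i $ j)"
  by (simp add: det_4 quat_op_cnj_eq quat_op_eq quat_coord_def quat_matrix_def quat_basis_def
     minor3_def phi_coeff_def idx_defs sum_4 del: minus_diff_eq) algebra

lemma quat_coord_phi_3:
  "quat_coord (quat_op_cnj (phi_coeff T) (Quat x0 x1 x2 x3)) 3 =
    - 3 * det (\<chi> i j. if j = 3 then quat_coord (Quat x0 x1 x2 x3) i else quat_matrix (quat_op T) $ i $ j)"
  by (simp add: det_4 quat_op_cnj_eq quat_op_eq quat_coord_def quat_matrix_def quat_basis_def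
     minor3_def phi_coeff_def idx_defs sum_4 del: minus_diff_eq) algebra

text \<open>Replacing column \<open>k\<close> of A by \<open>x\<close> gives a determinant equal to
  coordinate \<open>k\<close> of adj(A) x. The four coordinates are separate identities, cubic in
  \<open>T\<close> and linear in \<open>x\<close>.\<close>

lemma quat_coord_phi:
  "quat_coord (quat_op_cnj (phi_coeff T) x) k =
    - 3 * det (\<chi> i j. if j = k then quat_coord x i else quat_matrix (quat_op T) $ i $ j)"
proof (cases x)
  case (Quat x0 x1 x2 x3)
  have "\<forall>k. quat_coord (quat_op_cnj (phi_coeff T) (Quat x0 x1 x2 x3)) k =
    - 3 * det (\<chi> i j. if j = k then quat_coord (Quat x0 x1 x2 x3) i else quat_matrix (quat_op T) $ i $ j)"
    unfolding forall_4
    by (intro conjI quat_coord_phi_0 quat_coord_phi_1 quat_coord_phi_2 quat_coord_phi_3)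
  then show ?thesis unfolding Quat ..
qed

lemma linear_quat_op: "linear (quat_op T)"
  by (rule linearI)
    (simp_all add: quat_op_def algebra_simps sum.distrib scaleR_sum_right)

text \<open>This is adj(A) A = det(A): with A x as the replaced column, \<open>cramer_lemma\<close>
  returns x_k det(A).\<close>

lemma phi_quat_op:
  "quat_op_cnj (phi_coeff T) (quat_op T x) = (- 3 * det (quat_matrix (quat_op T))) *\<^sub>R x"
proof (rule quat_coord_eqI)
  fix k
  show "quat_coord (quat_op_cnj (phi_coeff T) (quat_op T x)) k =
      quat_coord ((- 3 * det (quat_matrix (quat_op T))) *\<^sub>R x) k"
    unfolding quat_coord_phi
    by (subst (1) quat_coord_matrix [OF linear_quat_op]) (simp add: cramer_lemma)
qed

text \<open>The operator (u | v) has trace 4 Re(u) Re(v), and conj(e_i) e_k has real part 1 or 0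
  according to whether i = k. Hence the trace extracts one coefficient of \<open>T\<close>.\<close>

lemma trace_conj_quat_op:
  "(\<Sum>k\<in>UNIV. quat_coord (qcnj (quat_basis i) * quat_op T (quat_basis k) * qcnj (quat_basis j)) k) =
    4 * T i j"
proof -
  have "\<forall>i j. (\<Sum>k\<in>UNIV. quat_coord (qcnj (quat_basis i) * quat_op T (quat_basis k) * qcnj (quat_basis j)) k) =
    4 * T i j"
    unfolding forall_4 sum_4
    by (simp add: quat_op_eq quat_coord_def quat_basis_def qcnj_def times_quaternion_def)
  then show ?thesis by simp
qed

lemma trace_quat_op_cnj:
  "(\<Sum>k\<in>UNIV. quat_coord (quat_op_cnj G (quat_op T (quat_basis k))) k) =
    4 * (\<Sum>i\<in>UNIV. \<Sum>j\<in>UNIV. G i j * T i j)"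
proof -
  have "(\<Sum>k\<in>UNIV. quat_coord (quat_op_cnj G (quat_op T (quat_basis k))) k) =
    (\<Sum>k\<in>UNIV. \<Sum>i\<in>UNIV. \<Sum>j\<in>UNIV. G i j *
      quat_coord (qcnj (quat_basis i) * quat_op T (quat_basis k) * qcnj (quat_basis j)) k)"
    by (simp add: quat_op_cnj_def)
  also have "\<dots> = (\<Sum>i\<in>UNIV. \<Sum>k\<in>UNIV. \<Sum>j\<in>UNIV. G i j *
      quat_coord (qcnj (quat_basis i) * quat_op T (quat_basis k) * qcnj (quat_basis j)) k)"
    by (rule sum.swap)
  also have "\<dots> = (\<Sum>i\<in>UNIV. \<Sum>j\<in>UNIV. \<Sum>k\<in>UNIV. G i j *
      quat_coord (qcnj (quat_basis i) * quat_op T (quat_basis k) * qcnj (quat_basis j)) k)"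
    by (rule sum.cong [OF refl sum.swap])
  also have "\<dots> = (\<Sum>i\<in>UNIV. \<Sum>j\<in>UNIV. G i j * (4 * T i j))"
    by (simp only: sum_distrib_left [symmetric] trace_conj_quat_op)
  also have "\<dots> = 4 * (\<Sum>i\<in>UNIV. \<Sum>j\<in>UNIV. G i j * T i j)"
    by (simp add: sum_distrib_left mult.left_commute)
  finally show ?thesis .
qed

text \<open>Take traces in \<open>phi_quat_op\<close>: the identity has trace 4, which cancels the 4
  of \<open>trace_quat_op_cnj\<close>. No quartic polynomials have to be compared.\<close>

lemma det_quat_op:
  "det (quat_matrix (quat_op T)) = - (\<Sum>i\<in>UNIV. \<Sum>j\<in>UNIV. phi_coeff T i j * T i j) / 3"
  using trace_quat_op_cnj [of "phi_coeff T" T] by (simp add: phi_quat_op)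


section \<open>Brackets and duals in coordinates\<close>

lemma less_4: "(0::4) < 1" "(0::4) < 2" "(0::4) < 3" "(1::4) < 2" "(1::4) < 3" "(2::4) < 3"
  by (simp_all add: less_bit0_def bit0.Rep_0 bit0.Rep_1 bit0.Rep_numeral)

lemma blade_coeff_cl_vec:
  "blade_coeff (cl_vec x) A = (\<Sum>i\<in>UNIV. if A = {i} then x $ i else 0)"
  by (auto simp: cl_vec_def if_distrib intro!: sum.cong)

lemma blade_coeff_cl_vec_singleton [simp]: "blade_coeff (cl_vec x) {i} = x $ i"
  by (simp add: blade_coeff_cl_vec)

lemma blade_coeff_cl_vec_eq_0: "card A \<noteq> 1 \<Longrightarrow> blade_coeff (cl_vec x) A = 0"
  by (auto simp: blade_coeff_cl_vec intro!: sum.neutral)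

lemma cl_vec_add: "cl_vec (x + y) = cl_vec x + cl_vec y"
  and cl_vec_scaleR: "cl_vec (t *\<^sub>R x) = t *\<^sub>R cl_vec x"
  by (simp_all add: cl_vec_def scaleR_add_left sum.distrib scaleR_sum_right)

lemma linear_cl_vec: "linear cl_vec"
  by (simp add: linearI cl_vec_add cl_vec_scaleR)

lemma inj_cl_vec: "inj cl_vec"
proof (rule injI)
  fix x y :: "real^'n::{finite,linorder}"
  assume "cl_vec x = cl_vec y"
  then have "blade_coeff (cl_vec x) {i} = blade_coeff (cl_vec y) {i}" for i by simp
  then show "x = y" by (simp add: vec_eq_iff)
qed

lemma blade_singleton_conv: "blade {i} = cl_vec (axis i 1)"
proof (rule clifford_eqI)
  fix A
  have "blade_coeff (cl_vec (axis i 1)) A = (\<Sum>j\<in>UNIV. if j = i then (if A = {i} then 1 else 0) else 0)"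
    unfolding blade_coeff_cl_vec by (intro sum.cong refl) (simp add: axis_def)
  then show "blade_coeff (blade {i}) A = blade_coeff (cl_vec (axis i 1)) A" by simp
qed

text \<open>A vector has grade one, so only the splittings of \<open>C\<close> that leave a
  singleton on the right survive. Outer products of vectors are computed from this factor by
  factor.\<close>

lemma blade_coeff_outer_cl_vec:
  fixes X :: "'n::{finite,linorder} clifford"
  shows "blade_coeff (X \<and>\<^sub>c cl_vec y) C =
    (\<Sum>i\<in>C. blade_sign (C - {i}) {i} * blade_coeff X (C - {i}) * y $ i)"
proof -
  let ?g = "\<lambda>A. blade_sign A (C - A) * blade_coeff X A * blade_coeff (cl_vec y) (C - A)"
  have inj: "inj_on (\<lambda>i. C - {i}) C"
    by (auto simp: inj_on_def)
  have "blade_coeff (X \<and>\<^sub>c cl_vec y) C = sum ?g (Pow C)"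
    by (simp add: outer_def)
  also have "\<dots> = sum ?g ((\<lambda>i. C - {i}) ` C)"
  proof (rule sum.mono_neutral_right)
    show "\<forall>A\<in>Pow C - (\<lambda>i. C - {i}) ` C. ?g A = 0"
    proof
      fix A assume A: "A \<in> Pow C - (\<lambda>i. C - {i}) ` C"
      have "card (C - A) \<noteq> 1"
      proof
        assume "card (C - A) = 1"
        then obtain i where i: "C - A = {i}" by (auto simp: card_1_singleton_iff)
        then have "A = C - {i}" "i \<in> C" using A by auto
        then show False using A by auto
      qed
      then show "?g A = 0" by (simp add: blade_coeff_cl_vec_eq_0)
    qed
  qed auto
  also have "\<dots> = (\<Sum>i\<in>C. ?g (C - {i}))"
    by (simp add: sum.reindex [OF inj])
  also have "\<dots> = (\<Sum>i\<in>C. blade_sign (C - {i}) {i} * blade_coeff X (C - {i}) * y $ i)"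
  proof (rule sum.cong [OF refl])
    fix i assume "i \<in> C"
    then have "C - (C - {i}) = {i}" by auto
    then show "?g (C - {i}) = blade_sign (C - {i}) {i} * blade_coeff X (C - {i}) * y $ i" by simp
  qed
  finally show ?thesis .
qed

lemma outer_cl_vec_grade:
  fixes X :: "'n::{finite,linorder} clifford"
  assumes "\<And>A. card A \<noteq> k \<Longrightarrow> blade_coeff X A = 0" and "card C \<noteq> Suc k"
  shows "blade_coeff (X \<and>\<^sub>c cl_vec y) C = 0"
proof -
  have "blade_coeff X (C - {i}) = 0" if "i \<in> C" for i
    using assms card_Suc_Diff1 [of C i] that by auto
  then show ?thesis by (simp add: blade_coeff_outer_cl_vec)
qed

text \<open>Right multiplication by the top blade complements index sets up to sign: it is a Hodge
  dual in coordinates.\<close>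

lemma blade_coeff_mult_blade_UNIV:
  fixes X :: "'n::{finite,linorder} clifford"
  shows "blade_coeff (X * blade UNIV) C = blade_sign (- C) UNIV * blade_coeff X (- C)"
proof -
  let ?f = "\<lambda>A. blade_sign A (sym_diff A C) * blade_coeff X A * blade_coeff (blade UNIV) (sym_diff A C)"
  have 0: "sym_diff (- C) C = UNIV" by auto
  have 1: "sym_diff A C = UNIV \<longleftrightarrow> A = - C" for A by auto
  have "?f A = (if A = - C then blade_sign (- C) UNIV * blade_coeff X (- C) else 0)" for A
    by (cases "A = - C") (simp_all only: 0 1 blade_coeff_blade if_True if_False simp_thms mult_1_right mult_zero_right)
  then show ?thesis
    by (simp add: times_clifford_def)
qed

text \<open>Multiplication by one blade permutes the blades up to sign, so that each coefficient of
  the product comes from a single coefficient of \<open>X\<close>.\<close>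

lemma blade_mult_coeff:
  fixes X :: "'n::{finite,linorder} clifford"
  shows "blade_coeff (blade B * X) (sym_diff B A) = blade_sign B A * blade_coeff X A"
    and "blade_coeff (X * blade B) (sym_diff A B) = blade_sign A B * blade_coeff X A"
proof -
  let ?f = "\<lambda>U V D C. blade_sign C (sym_diff C D) * blade_coeff U C * blade_coeff V (sym_diff C D)"
  have 0: "sym_diff B (sym_diff B A) = A" "sym_diff A (sym_diff A B) = B" by auto
  have 1: "sym_diff C (sym_diff A B) = B \<longleftrightarrow> C = A" for C by auto
  have "?f (blade B) X (sym_diff B A) C = (if C = B then blade_sign B A * blade_coeff X A else 0)" for C
    by (cases "C = B") (simp_all only: 0 blade_coeff_blade if_True if_False simp_thms mult_1_right mult_zero_right mult_zero_left)
  then show "blade_coeff (blade B * X) (sym_diff B A) = blade_sign B A * blade_coeff X A"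
    by (simp add: times_clifford_def)
  have "?f X (blade B) (sym_diff A B) C = (if C = A then blade_sign A B * blade_coeff X A else 0)" for C
    by (cases "C = A") (simp_all only: 0 1 blade_coeff_blade if_True if_False simp_thms mult_1_right mult_zero_right)
  then show "blade_coeff (X * blade B) (sym_diff A B) = blade_sign A B * blade_coeff X A"
    by (simp add: times_clifford_def)
qed

text \<open>
  $e_i$ and $e_A$ commute up to the sign $(-1)^{|A - \{i\}|}$, and only $A$ = \<open>UNIV\<close> makes
  this $-1$ for every $i$.
\<close>

lemma anticommute_imp_pseudoscalar:
  fixes X :: "'n::{finite,linorder} clifford"
  assumes "\<And>i. blade {i} * X = - (X * blade {i})"
  shows "X = blade_coeff X UNIV *\<^sub>R blade UNIV"
proof (rule clifford_eqI)
  fix A :: "'n set"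
  have "blade_coeff X A = 0" if A: "A \<noteq> UNIV"
  proof (rule ccontr)
    assume X: "blade_coeff X A \<noteq> 0"
    have odd: "odd (card (A - {i}))" for i
    proof -
      have s: "sym_diff A {i} = sym_diff {i} A" by auto
      have "blade_coeff (blade {i} * X) (sym_diff {i} A) =
        - blade_coeff (X * blade {i}) (sym_diff A {i})"
        unfolding s by (simp add: assms)
      then have "(blade_sign {i} A + blade_sign A {i}) * blade_coeff X A = 0"
        by (simp add: blade_mult_coeff distrib_right)
      then have e: "blade_sign {i} A = - blade_sign A {i}"
        using X by simp
      \<comment> \<open>For \<open>j\<close> different from \<open>i\<close>, exactly one of
        \<open>j < i\<close> and \<open>i < j\<close> holds and contributes -1.\<close>
      have "blade_sign {i} A * blade_sign A {i} = (\<Prod>j\<in>A. if j = i then 1 else - 1)"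
        by (auto simp: blade_sign_def prod.distrib [symmetric] intro!: prod.cong)
      also have "\<dots> = (\<Prod>j\<in>A - {i}. if j = i then 1 else - 1)"
        by (rule prod.mono_neutral_right) auto
      also have "\<dots> = (\<Prod>j\<in>A - {i}. - 1)"
        by (rule prod.cong) auto
      finally have "blade_sign {i} A * blade_sign A {i} = (- 1) ^ card (A - {i})" by simp
      moreover have "blade_sign {i} A * blade_sign A {i} = - 1"
        using e blade_sign_square [of A "{i}"] by simp
      ultimately show ?thesis
        by (cases "even (card (A - {i}))") simp_all
    qed
    \<comment> \<open>An index outside \<open>A\<close> forces the cardinality of \<open>A\<close>
      to be odd, an index inside forces it to be even.\<close>
    obtain i where "i \<notin> A" using A by auto
    with odd [of i] have c: "odd (card A)" by simp
    then obtain j where "j \<in> A" by fastforce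
    with odd [of j] c show False by (simp add: card_gt_0_iff)
  qed
  then show "blade_coeff X A = blade_coeff (blade_coeff X UNIV *\<^sub>R blade UNIV) A" by auto
qed

text \<open>Polarization: expand the square of \<open>x + y\<close> and apply
  \<open>cl_vec_square\<close> three times.\<close>

lemma cl_vec_anticommute:
  fixes x y :: "real^'n::{finite,linorder}"
  assumes "x \<bullet> y = 0"
  shows "cl_vec x * cl_vec y = - (cl_vec y * cl_vec x)"
proof -
  have "cl_vec (x + y) * cl_vec (x + y) = of_real (x \<bullet> x) + of_real (y \<bullet> y)"
    using assms by (simp add: cl_vec_square inner_add inner_commute [of y x])
  moreover have "cl_vec (x + y) * cl_vec (x + y) =
      cl_vec x * cl_vec x + cl_vec y * cl_vec y + (cl_vec x * cl_vec y + cl_vec y * cl_vec x)"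
    by (simp add: cl_vec_add algebra_simps)
  ultimately show ?thesis
    by (simp add: cl_vec_square eq_neg_iff_add_eq_0)
qed

text \<open>The generalized cross product in R^4: its inner product with \<open>w\<close> is the
  determinant with rows \<open>x\<close>, \<open>y\<close>, \<open>z\<close>,
  \<open>w\<close>.\<close>

definition normal :: "real^4 \<Rightarrow> real^4 \<Rightarrow> real^4 \<Rightarrow> real^4" where
  "normal x y z = (\<chi> i. minor3 ($) x y z (idx1 i) (idx2 i) (idx3 i))"

definition rows4 :: "'a \<Rightarrow> 'a \<Rightarrow> 'a \<Rightarrow> 'a \<Rightarrow> 4 \<Rightarrow> 'a" where
  "rows4 x y z w i = (if i = 0 then x else if i = 1 then y else if i = 2 then z else w)"

text \<open>Expansion along the last row; the even orderings in \<open>idx1\<close>,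
  \<open>idx2\<close>, \<open>idx3\<close> absorb the cofactor signs.\<close>

lemma det_rows4:
 "det (\<chi> i j. f (rows4 x y z w i) j) = (\<Sum>i\<in>UNIV. minor3 f x y z (idx1 i) (idx2 i) (idx3 i) * f w i)"
  by (simp add: det_4 rows4_def sum_4 minor3_def idx_defs algebra_simps)

lemma blade_coeff_outer2:
  fixes x y :: "real^'n::{finite,linorder}"
  assumes "i < j"
  shows "blade_coeff (cl_vec x \<and>\<^sub>c cl_vec y) {i, j} = x $ i * y $ j - x $ j * y $ i"
proof -
  have d: "{i, j} - {i} = {j}" "{i, j} - {j} = {i}" and "i \<noteq> j" using assms by auto
  have s: "blade_sign {j} {i} = - 1" "blade_sign {i} {j} = 1"
    using assms by (auto simp: blade_sign_def)
  show ?thesis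
    unfolding blade_coeff_outer_cl_vec using \<open>i \<noteq> j\<close> by (simp add: d s)
qed

lemma blade_coeff_outer3:
  fixes x y z :: "real^'n::{finite,linorder}"
  assumes "i < j" "j < k"
  shows "blade_coeff (cl_vec x \<and>\<^sub>c cl_vec y \<and>\<^sub>c cl_vec z) {i, j, k} = minor3 ($) x y z i j k"
proof -
  have "i < k" using assms by simp
  then have d: "{i, j, k} - {i} = {j, k}" "{i, j, k} - {j} = {i, k}" "{i, j, k} - {k} = {i, j}"
    and n: "i \<noteq> j" "j \<noteq> k" "i \<noteq> k" using assms by auto
  have s: "blade_sign {j, k} {i} = 1" "blade_sign {i, k} {j} = - 1" "blade_sign {i, j} {k} = 1"
    using assms \<open>i < k\<close> n by (auto simp: blade_sign_def)
  show ?thesis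
    using n assms \<open>i < k\<close>
    by (subst blade_coeff_outer_cl_vec) (simp add: d s blade_coeff_outer2 minor3_def algebra_simps)
qed

lemma Compl_singleton_4:
  "- {0::4} = {1, 2, 3}" "- {1::4} = {0, 2, 3}" "- {2::4} = {0, 1, 3}" "- {3::4} = {0, 1, 2}"
  unfolding Compl_eq_Diff_UNIV UNIV_4 by (simp_all add: insert_Diff_if)

lemma blade_sign_4:
  "blade_sign {1::4, 2, 3} UNIV = 1" "blade_sign {0::4, 2, 3} UNIV = - 1"
  "blade_sign {0::4, 1, 3} UNIV = 1" "blade_sign {0::4, 1, 2} UNIV = - 1"
  "blade_sign (UNIV :: 4 set) UNIV = 1"
  "blade_sign {1::4, 2, 3} {0} = - 1" "blade_sign {0::4, 2, 3} {1} = 1"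
  "blade_sign {0::4, 1, 3} {2} = - 1" "blade_sign {0::4, 1, 2} {3} = 1"
  unfolding UNIV_4 blade_sign_def
  by (simp_all add: less_4 less_4 [THEN less_not_sym])

text \<open>A trivector lives on triples, whose complements are singletons, so its dual is a vector.
  The signs of its four coordinates combine to one global minus.\<close>

lemma outer3_mult_blade_UNIV:
  "(cl_vec x \<and>\<^sub>c cl_vec y \<and>\<^sub>c cl_vec z) * blade UNIV = - cl_vec (normal x y z)"
proof (rule clifford_eqI)
  fix C :: "4 set"
  let ?V = "cl_vec x \<and>\<^sub>c cl_vec y \<and>\<^sub>c cl_vec z"
  show "blade_coeff (?V * blade UNIV) C = blade_coeff (- cl_vec (normal x y z)) C"
  proof (cases "card C = 1")
    case True
    then obtain i where i: "C = {i}" by (auto simp: card_1_singleton_iff)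
    have "\<forall>i. blade_coeff (?V * blade UNIV) {i} = - normal x y z $ i"
      unfolding blade_coeff_mult_blade_UNIV forall_4 Compl_singleton_4 blade_sign_4
      by (simp add: blade_coeff_outer3 less_4 normal_def minor3_def idx_defs algebra_simps)
    then show ?thesis by (simp add: i)
  next
    case False
    have "card (- C) \<noteq> 3"
      using False by (simp add: Compl_eq_Diff_UNIV card_Diff_subset)
    then have "blade_coeff ?V (- C) = 0"
      by (intro outer_cl_vec_grade [of 2] outer_cl_vec_grade [of 1] blade_coeff_cl_vec_eq_0) auto
    then show ?thesis
      using False by (simp add: blade_coeff_mult_blade_UNIV blade_coeff_cl_vec_eq_0)
  qed
qed

text \<open>The scalar part of the dual is the coefficient of the top blade, here expanded along the
  last factor \<open>w\<close>.\<close>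

lemma outer4_mult_blade_UNIV:
  "scalar_part ((cl_vec x \<and>\<^sub>c cl_vec y \<and>\<^sub>c cl_vec z \<and>\<^sub>c cl_vec w) * blade UNIV) =
    normal x y z \<bullet> (w :: real^4)"
  unfolding scalar_part_def blade_coeff_mult_blade_UNIV Compl_empty_eq
  by (subst blade_coeff_outer_cl_vec) (simp add: Compl_eq_Diff_UNIV [symmetric] Compl_singleton_4 blade_sign_4 blade_coeff_outer3
      less_4 inner_vec_def sum_4 normal_def minor3_def idx_defs algebra_simps)

section \<open>Orthonormal bases and their pseudoscalar\<close>

context
  fixes e :: "4 \<Rightarrow> real^4"
  assumes e: "orthonormal_basis4 e"
begin

lemma basis_inner: "e i \<bullet> e j = (if i = j then 1 else 0)"
  using e by (simp add: orthonormal_basis4_def)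

lemma qvec_inner_basis: "qvec e a \<bullet> e i = quat_coord a i"
  by (simp add: qvec_def inner_sum_left basis_inner if_distrib cong: if_cong)

lemma qvec_inner: "qvec e a \<bullet> qvec e b = (\<Sum>i\<in>UNIV. quat_coord a i * quat_coord b i)"
  by (subst (2) qvec_def) (simp add: inner_sum_right qvec_inner_basis mult.commute)

text \<open>For square matrices E E^t = 1 implies E^t E = 1, which is completeness of the
  orthonormal family.\<close>

lemma orthonormal_expand: "x = (\<Sum>i\<in>UNIV. (x \<bullet> e i) *\<^sub>R e i)"
proof -
  let ?E = "(\<chi> i. e i) :: real^4^4"
  have "?E ** transpose ?E = mat 1"
    by (simp add: vec_eq_iff matrix_matrix_mult_def transpose_def mat_def basis_inner [symmetric] inner_vec_def)
  then have "transpose ?E ** ?E = mat 1"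
    by (simp add: matrix_left_right_inverse)
  then have "x = transpose ?E *v (?E *v x)"
    by (simp add: matrix_vector_mul_assoc)
  also have "\<dots> = (\<Sum>i\<in>UNIV. (x \<bullet> e i) *\<^sub>R e i)"
    by (simp add: vec_eq_iff matrix_vector_mult_def transpose_def inner_vec_def mult.commute)
  finally show ?thesis .
qed

lemma det_basis_square: "det (\<chi> i j. e i $ j) * det (\<chi> i j. e i $ j) = 1"
proof -
  let ?E = "(\<chi> i j. e i $ j) :: real^4^4"
  have "?E ** transpose ?E = mat 1"
    by (simp add: vec_eq_iff matrix_matrix_mult_def transpose_def mat_def basis_inner [symmetric] inner_vec_def)
  then have "det (?E ** transpose ?E) = 1"
    by (simp only: det_I)
  then show ?thesis by (simp only: det_mul det_transpose)
qed

text \<open>A basis vector changes sign past the three other factors and commutes with itself; three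
  is odd. Linearity extends this to every \<open>x\<close>.\<close>

lemma pseudoscalar_anticommute: "cl_vec x * pseudoscalar e = - (pseudoscalar e * cl_vec x)"
proof -
  have c: "cl_vec (e i) * cl_vec (e j) = - (cl_vec (e j) * cl_vec (e i))" if "i \<noteq> j" for i j
    by (rule cl_vec_anticommute) (simp add: basis_inner that)
  have c': "cl_vec (e i) * (cl_vec (e j) * z) =
    - (cl_vec (e j) * (cl_vec (e i) * z))" if "i \<noteq> j" for i j z
    by (simp only: mult.assoc [symmetric] c [OF that] mult_minus_left)
  have "\<forall>i. cl_vec (e i) * pseudoscalar e = - (pseudoscalar e * cl_vec (e i))"
    unfolding forall_4 pseudoscalar_def mult.assoc
    \<comment> \<open>Only instances with the larger index on the left are given, so rewriting sorts
      the factors and terminates.\<close>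
    by (simp add: c [of 1 0] c [of 2 0] c [of 3 0] c [of 2 1] c [of 3 1] c [of 3 2]
      c' [of 1 0] c' [of 2 0] c' [of 3 0] c' [of 2 1] c' [of 3 1] c' [of 3 2])
  then have "cl_vec (\<Sum>i\<in>UNIV. a i *\<^sub>R e i) * pseudoscalar e =
      - (pseudoscalar e * cl_vec (\<Sum>i\<in>UNIV. a i *\<^sub>R e i))" for a
    by (simp add: linear_sum [OF linear_cl_vec] cl_vec_scaleR sum_distrib_left sum_distrib_right sum_negf)
  from this [of "\<lambda>i. x \<bullet> e i"] show ?thesis
    by (simp only: orthonormal_expand [of x, symmetric])
qed

lemma pseudoscalar_square: "pseudoscalar e * pseudoscalar e = 1"
proof -
  have c: "cl_vec (e i) * cl_vec (e j) = - (cl_vec (e j) * cl_vec (e i))" if "i \<noteq> j" for i j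
    by (rule cl_vec_anticommute) (simp add: basis_inner that)
  have c': "cl_vec (e i) * (cl_vec (e j) * z) =
    - (cl_vec (e j) * (cl_vec (e i) * z))" if "i \<noteq> j" for i j z
    by (simp only: mult.assoc [symmetric] c [OF that] mult_minus_left)
  have s: "cl_vec (e i) * cl_vec (e i) = 1" for i
    by (simp add: cl_vec_square basis_inner)
  have s': "cl_vec (e i) * (cl_vec (e i) * z) = z" for i z
    by (simp add: mult.assoc [symmetric] s)
  show ?thesis
    unfolding pseudoscalar_def mult.assoc
    by (simp add: s s' c [of 1 0] c [of 2 0] c [of 3 0] c [of 2 1] c [of 3 1] c [of 3 2]
      c' [of 1 0] c' [of 2 0] c' [of 3 0] c' [of 2 1] c' [of 3 1] c' [of 3 2])
qed

text \<open>Anticommuting with every vector leaves only the top blade, and having square 1 makes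
  \<open>t\<close> a sign.\<close>

lemma pseudoscalar_eq:
  obtains t where "pseudoscalar e = t *\<^sub>R blade UNIV" "t * t = 1"
proof
  let ?t = "blade_coeff (pseudoscalar e) UNIV"
  show eq: "pseudoscalar e = ?t *\<^sub>R blade UNIV"
    by (rule anticommute_imp_pseudoscalar) (simp add: blade_singleton_conv pseudoscalar_anticommute)
  have "blade_coeff (pseudoscalar e * pseudoscalar e) {} = ?t * ?t"
    by (subst (2) eq) (simp add: blade_coeff_mult_blade_UNIV blade_sign_4)
  then show "?t * ?t = 1"
    by (simp add: pseudoscalar_square one_clifford_def)
qed

text \<open>Change of basis: the matrix of the four vectors is their coordinate matrix times the
  matrix of \<open>e\<close>, and determinants multiply.\<close>

lemma normal_qvec:
  "normal (qvec e u) (qvec e v) (qvec e w) \<bullet> qvec e a =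
    det (\<chi> i j. e i $ j) *
      (\<Sum>i\<in>UNIV. minor3 quat_coord u v w (idx1 i) (idx2 i) (idx3 i) * quat_coord a i)"
proof -
  have "normal (qvec e u) (qvec e v) (qvec e w) \<bullet> qvec e a =
      det (\<chi> i j. rows4 (qvec e u) (qvec e v) (qvec e w) (qvec e a) i $ j)"
    unfolding det_rows4 by (simp add: inner_vec_def normal_def)
  also have "(\<chi> i j. rows4 (qvec e u) (qvec e v) (qvec e w) (qvec e a) i $ j) =
      (\<chi> i j. quat_coord (rows4 u v w a i) j) ** (\<chi> i j. e i $ j)"
    by (simp add: vec_eq_iff matrix_matrix_mult_def rows4_def qvec_def)
  finally show ?thesis
    by (simp add: det_mul det_rows4)
qed

text \<open>
  The sign \<open>s\<close> depends on the orientation of \<open>e\<close>.  It is the same for all arguments, and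
  \<open>Delta\<close> and \<open>Phi\<close> contain brackets and \<open>tri_dual\<close>s only in pairs.
\<close>

lemma bracket_tri_dual_coords:
  obtains s where "s * s = 1" and
    "\<And>u v w a. bracket e (qvec e u) (qvec e v) (qvec e w) (qvec e a) =
      s * (\<Sum>i\<in>UNIV. minor3 quat_coord u v w (idx1 i) (idx2 i) (idx3 i) * quat_coord a i)"
    and "\<And>u v w. tri_dual e u v w =
      s *\<^sub>R qcnj (\<Sum>i\<in>UNIV. minor3 quat_coord u v w (idx1 i) (idx2 i) (idx3 i) *\<^sub>R quat_basis i)"
proof -
  obtain t where t: "pseudoscalar e = t *\<^sub>R blade UNIV" "t * t = 1"
    by (rule pseudoscalar_eq)
  let ?d = "det (\<chi> i j. e i $ j)"
  show thesis
  proof (rule that [of "t * ?d"])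
    show "t * ?d * (t * ?d) = 1"
    proof -
      have "t * ?d * (t * ?d) = (t * t) * (?d * ?d)" by (simp only: ac_simps)
      then show ?thesis by (simp only: t(2) det_basis_square mult_1_right)
    qed
    show "bracket e (qvec e u) (qvec e v) (qvec e w) (qvec e a) =
      t * ?d * (\<Sum>i\<in>UNIV. minor3 quat_coord u v w (idx1 i) (idx2 i) (idx3 i) * quat_coord a i)"
      for u v w a
      using outer4_mult_blade_UNIV [of "qvec e u" "qvec e v" "qvec e w" "qvec e a"]
      by (simp add: bracket_def dual_def t scalar_part_def normal_qvec)
    fix u v w
    let ?k = "\<Sum>i\<in>UNIV. minor3 quat_coord u v w (idx1 i) (idx2 i) (idx3 i) *\<^sub>R quat_basis i"
    let ?n = "normal (qvec e (qcnj u)) (qvec e (qcnj v)) (qvec e (qcnj w))"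
    have k: "quat_coord ?k i = minor3 quat_coord u v w (idx1 i) (idx2 i) (idx3 i)" for i
      by (simp add: if_distrib cong: if_cong)
    have n: "?n \<bullet> e i = - ?d * quat_coord (qcnj ?k) i" for i
    proof -
      \<comment> \<open>Conjugation negates coordinates 1, 2, 3: the minor without coordinate 0
        picks up three signs, the others two.\<close>
      have "\<forall>i. minor3 quat_coord (qcnj u) (qcnj v) (qcnj w) (idx1 i) (idx2 i) (idx3 i) =
        - quat_coord (qcnj ?k) i"
        unfolding quat_coord_qcnj k forall_4
        by (simp add: quat_coord_qcnj minor3_def idx_defs algebra_simps)
      moreover have "?n \<bullet> qvec e (quat_basis i) =
        ?d * minor3 quat_coord (qcnj u) (qcnj v) (qcnj w) (idx1 i) (idx2 i) (idx3 i)"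
        unfolding normal_qvec by (simp add: if_distrib cong: if_cong)
      moreover have "qvec e (quat_basis i) = e i"
        by (simp add: qvec_def if_distrib [of "\<lambda>t. t *\<^sub>R _"] cong: if_cong)
      ultimately show ?thesis by simp
    qed
    have "- t *\<^sub>R ?n = (\<Sum>i\<in>UNIV. - t *\<^sub>R (?n \<bullet> e i) *\<^sub>R e i)"
      by (subst orthonormal_expand [of ?n]) (rule scaleR_sum_right)
    also have "\<dots> = (\<Sum>i\<in>UNIV. ((t * ?d) * quat_coord (qcnj ?k) i) *\<^sub>R e i)"
      by (simp only: n scaleR_scaleR mult_minus_left mult_minus_right minus_minus mult.assoc)
    also have "\<dots> = qvec e ((t * ?d) *\<^sub>R qcnj ?k)"
      by (simp only: qvec_def quat_coord_linear)
    finally have q: "- t *\<^sub>R ?n = qvec e ((t * ?d) *\<^sub>R qcnj ?k)" .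
    have "dual e (cl_vec (qvec e (qcnj u)) \<and>\<^sub>c cl_vec (qvec e (qcnj v)) \<and>\<^sub>c cl_vec (qvec e (qcnj w)))
        = cl_vec (- t *\<^sub>R ?n)"
      unfolding dual_def t(1) mult_scaleR_right outer3_mult_blade_UNIV cl_vec_scaleR by simp
    then have "dual e (cl_vec (qvec e (qcnj u)) \<and>\<^sub>c cl_vec (qvec e (qcnj v)) \<and>\<^sub>c cl_vec (qvec e (qcnj w)))
        = cl_vec (qvec e ((t * ?d) *\<^sub>R qcnj ?k))"
      unfolding q .
    \<comment> \<open>Injectivity lets \<open>inv\<close> in \<open>tri_dual_def\<close> return the
      quaternion whose image has just been computed.\<close>
    moreover have "inj (\<lambda>q. cl_vec (qvec e q))"
    proof (rule injI)
      fix p q assume "cl_vec (qvec e p) = cl_vec (qvec e q)"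
      then have "qvec e p = qvec e q" by (rule injD [OF inj_cl_vec])
      then show "p = q" by (metis qvec_inner_basis quat_coord_eqI)
    qed
    ultimately show "tri_dual e u v w = (t * ?d) *\<^sub>R qcnj ?k"
      unfolding tri_dual_def by (simp only:) (rule inv_f_f)
  qed
qed

end


section \<open>The operator $\Phi$ and the number $\Delta$\<close>

lemma sum_swap4:
  "(\<Sum>i\<in>A. \<Sum>j\<in>B. \<Sum>k\<in>C. \<Sum>l\<in>D. g i j k l) = (\<Sum>k\<in>C. \<Sum>l\<in>D. \<Sum>i\<in>A. \<Sum>j\<in>B. g i j k l)"
proof -
  have "(\<Sum>i\<in>A. \<Sum>j\<in>B. \<Sum>k\<in>C. \<Sum>l\<in>D. g i j k l) = (\<Sum>i\<in>A. \<Sum>k\<in>C. \<Sum>j\<in>B. \<Sum>l\<in>D. g i j k l)"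
    by (rule sum.cong [OF refl sum.swap])
  also have "\<dots> = (\<Sum>k\<in>C. \<Sum>i\<in>A. \<Sum>j\<in>B. \<Sum>l\<in>D. g i j k l)"
    by (rule sum.swap)
  also have "\<dots> = (\<Sum>k\<in>C. \<Sum>i\<in>A. \<Sum>l\<in>D. \<Sum>j\<in>B. g i j k l)"
    by (intro sum.cong refl sum.swap)
  also have "\<dots> = (\<Sum>k\<in>C. \<Sum>l\<in>D. \<Sum>i\<in>A. \<Sum>j\<in>B. g i j k l)"
    by (rule sum.cong [OF refl sum.swap])
  finally show ?thesis .
qed

lemma sum_product3:
  fixes f :: "'a \<Rightarrow> 'r::comm_semiring_0"
  shows "(\<Sum>p\<in>A. f p) * (\<Sum>q\<in>B. g q) * (\<Sum>r\<in>C. h r) = (\<Sum>p\<in>A. \<Sum>q\<in>B. \<Sum>r\<in>C. f p * g q * h r)"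
proof -
  have "f p * ((\<Sum>q\<in>B. g q) * (\<Sum>r\<in>C. h r)) = (\<Sum>q\<in>B. \<Sum>r\<in>C. f p * g q * h r)" for p
    unfolding sum_product unfolding sum_distrib_left by (simp only: mult.assoc)
  then show ?thesis
    by (simp only: mult.assoc [of "sum f A"] sum_distrib_right [of f A "sum g B * sum h C"])
qed

text \<open>The matrix T through which all the sums over the data factor.\<close>

definition moment :: "'i set \<Rightarrow> ('i \<Rightarrow> quaternion) \<Rightarrow> ('i \<Rightarrow> quaternion) \<Rightarrow> 4 \<Rightarrow> 4 \<Rightarrow> real" where
  "moment I c b i j = (\<Sum>r\<in>I. quat_coord (c r) i * quat_coord (b r) j)"

text \<open>By \<open>qvec_inner\<close> this is the inner product of the images under
  \<open>qvec e\<close>, for every orthonormal \<open>e\<close>.\<close>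

definition qdot :: "quaternion \<Rightarrow> quaternion \<Rightarrow> real" where
  "qdot u v = (\<Sum>i\<in>UNIV. quat_coord u i * quat_coord v i)"

lemma qdot_commute: "qdot u v = qdot v u"
  by (simp add: qdot_def mult.commute)

definition cross_coord :: "quaternion \<Rightarrow> quaternion \<Rightarrow> quaternion \<Rightarrow> 4 \<Rightarrow> real" where
  "cross_coord u v w i = minor3 quat_coord u v w (idx1 i) (idx2 i) (idx3 i)"

text \<open>The coefficient of the operator (conj e_j | conj e_k) in the summand of
  \<open>Phi\<close> with indices \<open>p\<close>, \<open>q\<close>, \<open>r\<close>.\<close>

definition phi_term ::
    "('i \<Rightarrow> quaternion) \<Rightarrow> ('i \<Rightarrow> quaternion) \<Rightarrow> 'i \<Rightarrow> 'i \<Rightarrow> 'i \<Rightarrow> 4 \<Rightarrow> 4 \<Rightarrow> real" where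
  "phi_term c b p q r j k =
     cross_coord (c p) (c q) (c r) j * cross_coord (b p) (b q) (b r) k
     + 3 * qdot (c p) (c r) * qdot (b p) (b r) * (quat_coord (c q) j * quat_coord (b q) k)
     - 6 * qdot (c p) (c r) * qdot (b q) (b r) * (quat_coord (c q) j * quat_coord (b p) k)"

lemma sum_cross_coord:
  "(\<Sum>p\<in>I. \<Sum>q\<in>I. \<Sum>r\<in>I. cross_coord (c p) (c q) (c r) j * cross_coord (b p) (b q) (b r) k) =
    6 * minor3 (moment I c b) (idx1 j) (idx2 j) (idx3 j) (idx1 k) (idx2 k) (idx3 k)"
proof -
  \<comment> \<open>Rows are relabelled by the summation indices, the form required by
    \<open>cauchy_binet3\<close>.\<close>
  have c: "cross_coord (x p) (x q) (x r) j =
      minor3 (\<lambda>p. quat_coord (x p)) p q r (idx1 j) (idx2 j) (idx3 j)"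
        for x :: "'a \<Rightarrow> quaternion" and p q r j
    by (simp add: cross_coord_def minor3_def)
  show ?thesis
    unfolding c cauchy_binet3 by (simp add: moment_def [abs_def])
qed

text \<open>Each summand is the Frobenius product of c_p b_p^t and c_r b_r^t, so the sum is the
  squared norm of T.\<close>

lemma sum_qdot_qdot:
  "(\<Sum>p\<in>I. \<Sum>r\<in>I. qdot (c p) (c r) * qdot (b p) (b r)) =
    (\<Sum>i\<in>UNIV. \<Sum>l\<in>UNIV. moment I c b i l * moment I c b i l)"
proof -
  have "qdot (c p) (c r) * qdot (b p) (b r) = (\<Sum>i\<in>UNIV. \<Sum>l\<in>UNIV.
      (quat_coord (c p) i * quat_coord (b p) l) * (quat_coord (c r) i * quat_coord (b r) l))"
        for p r
    unfolding qdot_def sum_product by (simp only: ac_simps)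
  then show ?thesis
    unfolding moment_def sum_product by (simp only:) (rule sum_swap4)
qed

text \<open>Grouping the factors by \<open>p\<close>, \<open>q\<close> and \<open>r\<close> gives
  one entry of T each; together they form an entry of T T^t T.\<close>

lemma sum_qdot_qdot_mixed:
  "(\<Sum>p\<in>I. \<Sum>q\<in>I. \<Sum>r\<in>I. qdot (c p) (c r) * qdot (b q) (b r) * (quat_coord (c q) j * quat_coord (b p) k)) =
    (\<Sum>i\<in>UNIV. \<Sum>l\<in>UNIV. moment I c b j l * moment I c b i l * moment I c b i k)"
proof -
  let ?g = "\<lambda>p q r i l. (quat_coord (c p) i * quat_coord (b p) k) *
      (quat_coord (c q) j * quat_coord (b q) l) * (quat_coord (c r) i * quat_coord (b r) l)"
  have "qdot (c p) (c r) * qdot (b q) (b r) * (quat_coord (c q) j * quat_coord (b p) k) =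
      (\<Sum>i\<in>UNIV. \<Sum>l\<in>UNIV. ?g p q r i l)" for p q r
    unfolding qdot_def sum_product unfolding sum_distrib_right by (simp only: ac_simps)
  then have "(\<Sum>p\<in>I. \<Sum>q\<in>I. \<Sum>r\<in>I. qdot (c p) (c r) * qdot (b q) (b r) * (quat_coord (c q) j * quat_coord (b p) k)) =
      (\<Sum>p\<in>I. \<Sum>q\<in>I. \<Sum>r\<in>I. \<Sum>i\<in>UNIV. \<Sum>l\<in>UNIV. ?g p q r i l)"
    by (simp only:)
  also have "\<dots> = (\<Sum>p\<in>I. \<Sum>i\<in>UNIV. \<Sum>l\<in>UNIV. \<Sum>q\<in>I. \<Sum>r\<in>I. ?g p q r i l)"
    by (intro sum.cong refl sum_swap4)
  also have "\<dots> = (\<Sum>i\<in>UNIV. \<Sum>p\<in>I. \<Sum>l\<in>UNIV. \<Sum>q\<in>I. \<Sum>r\<in>I. ?g p q r i l)"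
    by (rule sum.swap)
  also have "\<dots> = (\<Sum>i\<in>UNIV. \<Sum>l\<in>UNIV. \<Sum>p\<in>I. \<Sum>q\<in>I. \<Sum>r\<in>I. ?g p q r i l)"
    by (rule sum.cong [OF refl sum.swap])
  also have "\<dots> = (\<Sum>i\<in>UNIV. \<Sum>l\<in>UNIV. moment I c b i k * moment I c b j l * moment I c b i l)"
    unfolding moment_def sum_product3 ..
  finally show ?thesis by (simp only: ac_simps)
qed

lemma sum_phi_term:
  "(\<Sum>p\<in>I. \<Sum>q\<in>I. \<Sum>r\<in>I. phi_term c b p q r j k) = phi_coeff (moment I c b) j k"
proof -
  have "(\<Sum>p\<in>I. \<Sum>q\<in>I. \<Sum>r\<in>I. qdot (c p) (c r) * qdot (b p) (b r) * (quat_coord (c q) j * quat_coord (b q) k)) =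
      (\<Sum>p\<in>I. \<Sum>r\<in>I. \<Sum>q\<in>I. qdot (c p) (c r) * qdot (b p) (b r) * (quat_coord (c q) j * quat_coord (b q) k))"
    by (rule sum.cong [OF refl sum.swap])
  also have "\<dots> = (\<Sum>i\<in>UNIV. \<Sum>l\<in>UNIV. moment I c b i l * moment I c b i l) * moment I c b j k"
    unfolding sum_qdot_qdot [symmetric] sum_distrib_right
    by (simp only: moment_def sum_distrib_left)
  finally show ?thesis
    by (simp add: phi_term_def phi_coeff_def sum.distrib sum_subtractf mult.assoc sum_distrib_left [symmetric]
        sum_cross_coord sum_qdot_qdot_mixed [unfolded mult.assoc])
qed

text \<open>The factor T supplies the fourth index \<open>s\<close>, and contracting over
  \<open>j\<close> and \<open>k\<close> turns coordinates back into inner products and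
  brackets.\<close>

lemma phi_coeff_inner_moment:
  "(\<Sum>j\<in>UNIV. \<Sum>k\<in>UNIV. phi_coeff (moment I c b) j k * moment I c b j k) =
    (\<Sum>p\<in>I. \<Sum>q\<in>I. \<Sum>r\<in>I. \<Sum>s\<in>I.
      (\<Sum>i\<in>UNIV. cross_coord (c p) (c q) (c r) i * quat_coord (c s) i) *
      (\<Sum>i\<in>UNIV. cross_coord (b p) (b q) (b r) i * quat_coord (b s) i)
      + 3 * qdot (c p) (c q) * qdot (c r) (c s) * qdot (b p) (b q) * qdot (b r) (b s)
      - 6 * qdot (c p) (c q) * qdot (c r) (c s) * qdot (b q) (b s) * qdot (b p) (b r))"
proof -
  let ?x = "\<lambda>p q r s. (\<Sum>i\<in>UNIV. cross_coord (c p) (c q) (c r) i * quat_coord (c s) i) *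
      (\<Sum>i\<in>UNIV. cross_coord (b p) (b q) (b r) i * quat_coord (b s) i)"
  let ?y = "\<lambda>p q r s. 3 * qdot (c p) (c q) * qdot (c r) (c s) * qdot (b p) (b q) * qdot (b r) (b s)"
  let ?z = "\<lambda>p q r s. 6 * qdot (c p) (c q) * qdot (c r) (c s) * qdot (b q) (b s) * qdot (b p) (b r)"
  let ?t = "\<lambda>s j k. quat_coord (c s) j * quat_coord (b s) k"
  have W: "(\<Sum>j\<in>UNIV. \<Sum>k\<in>UNIV. phi_term c b p q r j k * ?t s j k) =
    ?x p q r s + ?y p r q s - ?z p r s q"
    for p q r s
  proof -
    have "phi_term c b p q r j k * ?t s j k =
        (cross_coord (c p) (c q) (c r) j * quat_coord (c s) j) * (cross_coord (b p) (b q) (b r) k * quat_coord (b s) k)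
        + (3 * qdot (c p) (c r) * qdot (b p) (b r)) *
          ((quat_coord (c q) j * quat_coord (c s) j) * (quat_coord (b q) k * quat_coord (b s) k))
        - (6 * qdot (c p) (c r) * qdot (b q) (b r)) *
          ((quat_coord (c q) j * quat_coord (c s) j) * (quat_coord (b p) k * quat_coord (b s) k))" for j k
      by (simp add: phi_term_def algebra_simps)
    then have "(\<Sum>j\<in>UNIV. \<Sum>k\<in>UNIV. phi_term c b p q r j k * ?t s j k) =
        ?x p q r s
        + (3 * qdot (c p) (c r) * qdot (b p) (b r)) * (qdot (c q) (c s) * qdot (b q) (b s))
        - (6 * qdot (c p) (c r) * qdot (b q) (b r)) * (qdot (c q) (c s) * qdot (b p) (b s))"
      by (simp only: sum.distrib sum_subtractf sum_distrib_left [symmetric] sum_distrib_right [symmetric] qdot_def)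
    then show ?thesis
      by (simp add: qdot_commute [of "c s" "c q"] qdot_commute [of "b r" "b q"] algebra_simps)
  qed
  have "(\<Sum>j\<in>UNIV. \<Sum>k\<in>UNIV. phi_coeff (moment I c b) j k * moment I c b j k) =
      (\<Sum>j\<in>UNIV. \<Sum>k\<in>UNIV. \<Sum>p\<in>I. \<Sum>q\<in>I. \<Sum>r\<in>I. \<Sum>s\<in>I. phi_term c b p q r j k * ?t s j k)"
    unfolding sum_phi_term [symmetric] sum_distrib_right
    by (simp only: moment_def sum_distrib_left)
  also have "\<dots> = (\<Sum>p\<in>I. \<Sum>q\<in>I. \<Sum>j\<in>UNIV. \<Sum>k\<in>UNIV. \<Sum>r\<in>I. \<Sum>s\<in>I. phi_term c b p q r j k * ?t s j k)"
    by (rule sum_swap4)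
  also have "\<dots> = (\<Sum>p\<in>I. \<Sum>q\<in>I. \<Sum>r\<in>I. \<Sum>s\<in>I. \<Sum>j\<in>UNIV. \<Sum>k\<in>UNIV. phi_term c b p q r j k * ?t s j k)"
    by (intro sum.cong refl sum_swap4)
  also have "\<dots> = (\<Sum>p\<in>I. \<Sum>q\<in>I. \<Sum>r\<in>I. \<Sum>s\<in>I. ?x p q r s)
      + (\<Sum>p\<in>I. \<Sum>q\<in>I. \<Sum>r\<in>I. \<Sum>s\<in>I. ?y p r q s)
      - (\<Sum>p\<in>I. \<Sum>q\<in>I. \<Sum>r\<in>I. \<Sum>s\<in>I. ?z p r s q)"
    by (simp only: W sum.distrib sum_subtractf)
  \<comment> \<open>The contraction produces the indices of \<open>?y\<close> and \<open>?z\<close>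
    in another order; swapping sums restores the order used in \<open>Delta\<close>.\<close>
  also have "(\<Sum>p\<in>I. \<Sum>q\<in>I. \<Sum>r\<in>I. \<Sum>s\<in>I. ?y p r q s) = (\<Sum>p\<in>I. \<Sum>q\<in>I. \<Sum>r\<in>I. \<Sum>s\<in>I. ?y p q r s)"
    by (rule sum.cong [OF refl sum.swap])
  also have "(\<Sum>p\<in>I. \<Sum>q\<in>I. \<Sum>r\<in>I. \<Sum>s\<in>I. ?z p r s q) = (\<Sum>p\<in>I. \<Sum>r\<in>I. \<Sum>q\<in>I. \<Sum>s\<in>I. ?z p r s q)"
    by (rule sum.cong [OF refl sum.swap])
  also have "\<dots> = (\<Sum>p\<in>I. \<Sum>r\<in>I. \<Sum>s\<in>I. \<Sum>q\<in>I. ?z p r s q)"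
    by (intro sum.cong refl sum.swap)
  finally show ?thesis
    by (simp only: sum.distrib sum_subtractf)
qed

lemma Delta_eq:
  assumes "orthonormal_basis4 e"
  shows "Delta e n c b =
    (\<Sum>j\<in>UNIV. \<Sum>k\<in>UNIV. phi_coeff (moment {1..n-1} c b) j k * moment {1..n-1} c b j k)"
proof -
  obtain s where s: "s * s = 1" and br:
    "\<And>u v w a. bracket e (qvec e u) (qvec e v) (qvec e w) (qvec e a) =
      s * (\<Sum>i\<in>UNIV. cross_coord u v w i * quat_coord a i)"
    using bracket_tri_dual_coords [OF assms] unfolding cross_coord_def by metis
  have s': "s * x * (s * y) = x * y" for x y :: real
    using s by (metis mult.assoc mult.left_commute mult_1)
  show ?thesis
    unfolding phi_coeff_inner_moment Delta_def Let_def br s' qvec_inner [OF assms] qdot_def ..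
qed

text \<open>Every summand becomes a multiple of a rank-one \<open>quat_op_cnj\<close>, after which
  the coefficients alone are added.\<close>

lemma Phi_eq:
  assumes "orthonormal_basis4 e"
  shows "Phi e n c b x = quat_op_cnj (phi_coeff (moment {1..n-1} c b)) x"
proof -
  let ?k = "\<lambda>u v w. \<Sum>i\<in>UNIV. cross_coord u v w i *\<^sub>R quat_basis i"
  obtain s where s: "s * s = 1" and tri: "\<And>u v w. tri_dual e u v w = s *\<^sub>R qcnj (?k u v w)"
    using bracket_tri_dual_coords [OF assms] unfolding cross_coord_def by metis
  have k: "quat_coord (?k u v w) i = cross_coord u v w i" for u v w i
    by (simp add: if_distrib cong: if_cong)
  have t: "two_sided (tri_dual e u v w) (tri_dual e u' v' w') x =
      quat_op_cnj (\<lambda>j k. cross_coord u v w j * cross_coord u' v' w' k) x" for u v w u' v' w'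
  proof -
    have "two_sided (tri_dual e u v w) (tri_dual e u' v' w') x =
        (s * s) *\<^sub>R (qcnj (?k u v w) * x * qcnj (?k u' v' w'))"
      by (simp add: two_sided_def tri)
    then show ?thesis
      by (simp only: s scaleR_one quat_op_cnj_rank1 [symmetric] k)
  qed
  have "Phi e n c b x =
      (\<Sum>p\<in>{1..n-1}. \<Sum>q\<in>{1..n-1}. \<Sum>r\<in>{1..n-1}. quat_op_cnj (phi_term c b p q r) x)"
    unfolding Phi_def Let_def t qvec_inner [OF assms] qdot_def [symmetric]
    unfolding two_sided_def quat_op_cnj_rank1 [symmetric] quat_op_cnj_scaleR quat_op_cnj_add quat_op_cnj_diff
    by (simp only: phi_term_def [abs_def])
  also have "\<dots> = quat_op_cnj (phi_coeff (moment {1..n-1} c b)) x"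
    by (simp only: quat_op_cnj_sum sum_phi_term)
  finally show ?thesis .
qed

theorem theorem6p2:
  fixes n \<alpha> :: nat
    and c b :: "nat \<Rightarrow> quaternion"
    and d h :: quaternion
    and e :: "4 \<Rightarrow> real^4"
    and F :: "quaternion \<Rightarrow> quaternion"
    and M A :: "real^4^4"
    and \<Delta> :: real
    and \<Phi> :: "quaternion \<Rightarrow> quaternion"
  assumes "n \<ge> 2" and "\<alpha> < n"
    and "orthonormal_basis4 e"
    and "F = (\<lambda>q. (\<Sum>r=1..\<alpha>. c r * q * b r) - (\<Sum>r=\<alpha>+1..n-1. c r * qcnj q * b r))"
    and "M = quat_matrix F"
    and "A = quat_matrix (\<lambda>q. \<Sum>r=1..n-1. c r * q * b r)"
    and "h = (\<Sum>r=1..\<alpha>. c r * b r) - (\<Sum>r=\<alpha>+1..n-1. c r * b r)"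
    and "\<Delta> = Delta e n c b"
    and "\<Phi> = Phi e n c b"
  shows "det A = - \<Delta> / 3 \<and> det M = - qRe (\<Phi> h) / 3 \<and>
    (det A \<noteq> 0 \<and> det M \<noteq> 0 \<longrightarrow>
      (\<exists>!q. F q = d) \<and>
      (\<forall>q. F q = d \<longrightarrow>
        (\<Delta> * qRe (\<Phi> h)) *\<^sub>R q =
          of_real (\<Delta> * qRe (\<Phi> d)) - qRe (\<Phi> d) *\<^sub>R \<Phi> h + qRe (\<Phi> h) *\<^sub>R \<Phi> d))"
proof -
  let ?T = "moment {1..n-1} c b" and ?L = "\<lambda>q. \<Sum>r=1..n-1. c r * q * b r"
  let ?h' = "\<Sum>r=\<alpha>+1..n-1. c r * b r"
  have L: "?L = quat_op ?T"
    by (simp add: fun_eq_iff quat_op_rank1 [symmetric] quat_op_sum moment_def [abs_def])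
  have detA: "det A = - \<Delta> / 3"
    unfolding assms(6,8) L det_quat_op Delta_eq [OF assms(3)] ..
  have \<Phi>: "\<Phi> = quat_op_cnj (phi_coeff ?T)"
    using assms(9) by (simp add: fun_eq_iff Phi_eq [OF assms(3)])
  have lin\<Phi>: "linear \<Phi>"
    unfolding \<Phi> by (rule linear_quat_op_cnj)
  \<comment> \<open>The hypothesis \<open>\<alpha> < n\<close> makes \<open>n - 1 - \<alpha>\<close>
    a true difference; either of the two ranges may be empty.\<close>
  have split: "(\<Sum>r=1..n-1. g r) = (\<Sum>r=1..\<alpha>. g r) + (\<Sum>r=\<alpha>+1..n-1. g r)" for g :: "nat \<Rightarrow> quaternion"
    using assms(2) sum.ub_add_nat [of 1 \<alpha> g "n - 1 - \<alpha>"] by simp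
  have qcnj: "qcnj q = (2 * qRe q) *\<^sub>R 1 - q" for q
    by (cases q) (simp add: qcnj_def quaternion_defs)
  have h: "h = ?L 1 - 2 *\<^sub>R ?h'"
    unfolding assms(7) split by (simp add: scaleR_2)
  have F: "F q = ?L q - (2 * qRe q) *\<^sub>R ?h'" for q
    unfolding assms(4) split
    by (simp add: qcnj algebra_simps sum_subtractf scaleR_sum_right)
  have linL: "linear ?L"
    unfolding L by (rule linear_quat_op)
  have "linear (\<lambda>q. (2 * qRe q) *\<^sub>R ?h')"
    by (rule linearI) (simp_all add: quat_coord_0 [symmetric] algebra_simps)
  from linear_compose_sub [OF linL this] have linF: "linear F"
    unfolding F [symmetric] .
  \<comment> \<open>\<open>F\<close> and \<open>?L\<close> agree on the imaginary units, whose real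
    part is 0, and \<open>F\<close> sends 1 to \<open>h\<close>.\<close>
  have M: "M = (\<chi> i j. if j = 0 then quat_coord h i else quat_matrix (quat_op ?T) $ i $ j)"
  proof -
    have "F (quat_basis j) = (if j = 0 then h else ?L (quat_basis j))" for j
      using quat_coord_basis [of j 0] by (simp add: F h quat_coord_0 quat_basis_0)
    then show ?thesis
      unfolding assms(5) L [symmetric] by (simp add: quat_matrix_def vec_eq_iff)
  qed
  have detM: "det M = - qRe (\<Phi> h) / 3"
    using quat_coord_phi [of ?T h 0] by (simp add: M \<Phi> quat_coord_0)
  have key: "(\<Delta> * qRe (\<Phi> h)) *\<^sub>R q =
      of_real (\<Delta> * qRe (\<Phi> d)) - qRe (\<Phi> d) *\<^sub>R \<Phi> h + qRe (\<Phi> h) *\<^sub>R \<Phi> d" if "F q = d" for q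
  proof -
    have \<Phi>L: "\<Phi> (?L x) = \<Delta> *\<^sub>R x" for x
    proof -
      have "\<Delta> = - 3 * det (quat_matrix (quat_op ?T))"
        using detA unfolding assms(6) L by linarith
      then show ?thesis
        unfolding fun_cong [OF L] \<Phi> phi_quat_op by (simp only:)
    qed
    have "d = ?L q - qRe q *\<^sub>R ?L 1 + qRe q *\<^sub>R h"
      unfolding that [symmetric] F h by (simp add: algebra_simps)
    then have d: "\<Phi> d = \<Delta> *\<^sub>R q - (\<Delta> * qRe q) *\<^sub>R 1 + qRe q *\<^sub>R \<Phi> h"
      by (simp only: linear_add [OF lin\<Phi>] linear_diff [OF lin\<Phi>] linear_cmul [OF lin\<Phi>] \<Phi>L scaleR_scaleR mult.commute)
    \<comment> \<open>The first two terms of \<open>d\<close> cancel in the real part.\<close>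
    have Re: "qRe (\<Phi> d) = qRe q * qRe (\<Phi> h)"
      unfolding d by (simp add: quaternion_defs)
    \<comment> \<open>\<open>Re\<close> is unfolded first, while \<open>qRe (\<Phi> d)\<close> is
      still present; \<open>d\<close> then rewrites the remaining \<open>\<Phi> d\<close>.\<close>
    show ?thesis
      unfolding Re unfolding d of_real_def
      by (simp add: algebra_simps)
  qed
  have "\<exists>!q. F q = d" if "det M \<noteq> 0"
  proof -
    have M': "F q = d \<longleftrightarrow> M *v (\<chi> j. quat_coord q j) = (\<chi> j. quat_coord d j)" for q
      using quat_coord_matrix [OF linF, of q] quat_coord_eqI [of "F q" d]
      by (auto simp: assms(5) vec_eq_iff)
    \<comment> \<open>The coordinates given by Cramer's rule; \<open>cramer\<close> is an
      equivalence and so yields existence and uniqueness together.\<close>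
    let ?s = "\<chi> k. det (\<chi> i j. if j = k then quat_coord d i else M $ i $ j) / det M"
    have "F q = d \<longleftrightarrow> (\<chi> j. quat_coord q j) = ?s" for q
      unfolding M' cramer [OF that] vec_lambda_beta ..
    moreover have "(\<chi> j. quat_coord q j) = ?s \<longleftrightarrow> q = (\<Sum>j\<in>UNIV. (?s $ j) *\<^sub>R quat_basis j)" for q
    proof
      assume "(\<chi> j. quat_coord q j) = ?s"
      then have "quat_coord q j = ?s $ j" for j by (metis vec_lambda_beta)
      then show "q = (\<Sum>j\<in>UNIV. (?s $ j) *\<^sub>R quat_basis j)"
        using quat_basis_coord [of q] by (simp only:)
    qed (simp add: vec_eq_iff if_distrib cong: if_cong)
    ultimately show ?thesis by (simp only: ex1_eq)
  qed
  with detA detM key show ?thesis by blast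
qed

end
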